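(* Let $\mathcal L$ denote the set of conjugacy classes of loxodromic elements of $\mathrm{SL}(2,\mathbb H)$, and $\mathcal L^{\mathrm{reg}}\subset\mathcal L$ the subset of regular classes. Write $x=\mathrm{tr}(A)$, $y=\mathrm{tr}(A^{-1})$, $z=\nu(A)$. (1) The map $\Theta\colon\mathcal L\to\mathbb R^3$, $[A]\mapsto(x,y,z)$, is injective. (2) The coefficients of the characteristic polynomial $\chi_A(t)=t^4-c_3t^3+c_2t^2-c_1t+1$ are recovered by $c_3=2x$, $c_1=2y$ and $$c_2=z+\frac{4(xyz-x^2-y^2)}{z^2-4}=z+\frac{4}{z-2}\Bigl(xy-\frac{(x+y)^2}{z+2}\Bigr).$$ Equivalently $\mathrm{tr}(A^2)=2x^2-c_2$, so $[A]\mapsto(\mathrm{tr}A,\mathrm{tr}A^{-1},\mathrm{tr}A^2)$ is also injective on $\mathcal L$, and the two triples determine one another. (3) $\Theta$ maps $\mathcal L^{\mathrm{reg}}$ real-analytically and bijectively onto the open set $$\mathcal D:=\{(x,y,z)\in\mathbb R^3: z>2,\ |u|<1,\ |v|<1\},$$ where $$u=\frac12\Bigl(\frac{x+y}{\sqrt{z+2}}+\frac{x-y}{\sqrt{z-2}}\Bigr),\qquad v=\frac12\Bigl(\frac{x+y}{\sqrt{z+2}}-\frac{x-y}{\sqrt{z-2}}\Bigr),$$ with inverse determined by $r=\frac12(\sqrt{z+2}+\sqrt{z-2})$, $\cos\theta=u$, $\cos\varphi=v$. In particular $\Theta|_{\mathcal L^{\mathrm{reg}}}$ is a homeomorphism onto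 $\mathcal D$ and every point of $\mathcal D$ is realised.
   Context: $\mathbb H$ denotes the quaternions, with real part $\mathrm{Re}$ and norm $|\cdot|$; $\mathbb S^2=\{I\in\mathbb H: I^2=-1\}$; $e^{I\theta}=\cos\theta+I\sin\theta$ for $I\in\mathbb S^2$. The Dieudonné determinant of $\left(\begin{smallmatrix}a&b\\c&d\end{smallmatrix}\right)\in\mathrm{GL}(2,\mathbb H)$ is $|ad-aca^{-1}b|$ if $a\neq0$ and $|cb|$ if $a=0$; $\mathrm{SL}(2,\mathbb H)$ is the group of matrices of Dieudonné determinant $1$, acting on $\widehat{\mathbb H}=\mathbb H\cup\{\infty\}$ by $z\mapsto(az+b)(cz+d)^{-1}$. $A\in\mathrm{SL}(2,\mathbb H)$ is loxodromic if it has exactly two fixed points in $\widehat{\mathbb H}$, one attracting and one repelling; equivalently, $A$ is conjugate in $\mathrm{SL}(2,\mathbb H)$ to $\mathrm{diag}(re^{I\theta},r^{-1}e^{J\varphi})$ with $r>1$, $\theta,\varphi\in[0,\pi]$, $I,J\in\mathbb S^2$. It is regular loxodromic if moreover $\theta,\varphi\in(0,\pi)$. The numbers $(r,\theta,\varphi)$ depend only on the class, and identify $\mathcal L^{\mathrm{reg}}$ with $(1,\infty)\times(0,\pi)^2$, giving its topology and real-analytic structure. For $A=\left(\begin{smallmatrix}a&b\\c&d\end{smallmatrix}\right)$, $\mathrm{tr}(A):=\mathrm{Re}(a+d)$. For $A$ loxodromic, $\nu(A):=r^2+r^{-2}$. Let $\Phi:\mathrm M(2,\mathbb H)\to\mathrm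 M(4,\mathbb C)$ be the real-algebra embedding obtained by replacing each entry $q=z+wj$ ($z,w\in\mathbb C=\mathbb R+\mathbb Ri$) by $\left(\begin{smallmatrix}z&w\\-\bar w&\bar z\end{smallmatrix}\right)$; then $\chi_A(t)=\det(tI_4-\Phi(A))$, which has real coefficients and constant term $1$ for $A\in\mathrm{SL}(2,\mathbb H)$. *)

theory Defs
  imports
    "HOL-Analysis.Analysis"
    "HOL-Computational_Algebra.Polynomial"
begin

section \<open>Quaternions\<close>

datatype quat = Quat (Re0: real) (Im1: real) (Im2: real) (Im3: real)

lemma quat_eq_iff:
  "p = q \<longleftrightarrow> Re0 p = Re0 q \<and> Im1 p = Im1 q \<and> Im2 p = Im2 q \<and> Im3 p = Im3 q"
  by (cases p; cases q) simp

instantiation quat :: ring_1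
begin

definition "0 = Quat 0 0 0 0"
definition "1 = Quat 1 0 0 0"
definition "p + q = Quat (Re0 p + Re0 q) (Im1 p + Im1 q) (Im2 p + Im2 q) (Im3 p + Im3 q)"
definition "- p = Quat (- Re0 p) (- Im1 p) (- Im2 p) (- Im3 p)"
definition "p - q = Quat (Re0 p - Re0 q) (Im1 p - Im1 q) (Im2 p - Im2 q) (Im3 p - Im3 q)"
definition
  "p * q = Quat
     (Re0 p * Re0 q - Im1 p * Im1 q - Im2 p * Im2 q - Im3 p * Im3 q)
     (Re0 p * Im1 q + Im1 p * Re0 q + Im2 p * Im3 q - Im3 p * Im2 q)
     (Re0 p * Im2 q - Im1 p * Im3 q + Im2 p * Re0 q + Im3 p * Im1 q)
     (Re0 p * Im3 q + Im1 p * Im2 q - Im2 p * Im1 q + Im3 p * Re0 q)"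

instance
  by standard
     (simp_all add: quat_eq_iff zero_quat_def one_quat_def plus_quat_def uminus_quat_def
        minus_quat_def times_quat_def algebra_simps)

end

lemma quat_sel [simp]:
  "Re0 0 = 0" "Im1 0 = 0" "Im2 0 = 0" "Im3 0 = 0"
  "Re0 1 = 1" "Im1 1 = 0" "Im2 1 = 0" "Im3 1 = 0"
  "Re0 (p + q) = Re0 p + Re0 q" "Im1 (p + q) = Im1 p + Im1 q"
  "Im2 (p + q) = Im2 p + Im2 q" "Im3 (p + q) = Im3 p + Im3 q"
  "Re0 (- p) = - Re0 p" "Im1 (- p) = - Im1 p" "Im2 (- p) = - Im2 p" "Im3 (- p) = - Im3 p"
  "Re0 (p - q) = Re0 p - Re0 q" "Im1 (p - q) = Im1 p - Im1 q"
  "Im2 (p - q) = Im2 p - Im2 q" "Im3 (p - q) = Im3 p - Im3 q"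
  "Re0 (p * q) = Re0 p * Re0 q - Im1 p * Im1 q - Im2 p * Im2 q - Im3 p * Im3 q"
  "Im1 (p * q) = Re0 p * Im1 q + Im1 p * Re0 q + Im2 p * Im3 q - Im3 p * Im2 q"
  "Im2 (p * q) = Re0 p * Im2 q - Im1 p * Im3 q + Im2 p * Re0 q + Im3 p * Im1 q"
  "Im3 (p * q) = Re0 p * Im3 q + Im1 p * Im2 q - Im2 p * Im1 q + Im3 p * Re0 q"
  by (simp_all add: zero_quat_def one_quat_def plus_quat_def uminus_quat_def
        minus_quat_def times_quat_def)

instantiation quat :: real_algebra_1
begin

definition "scaleR r q = Quat (r * Re0 q) (r * Im1 q) (r * Im2 q) (r * Im3 q)"

instance
  by standard (simp_all add: quat_eq_iff scaleR_quat_def algebra_simps)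

end

lemma quat_sel_scaleR [simp]:
  "Re0 (r *\<^sub>R q) = r * Re0 q" "Im1 (r *\<^sub>R q) = r * Im1 q"
  "Im2 (r *\<^sub>R q) = r * Im2 q" "Im3 (r *\<^sub>R q) = r * Im3 q"
  by (simp_all add: scaleR_quat_def)

definition qnorm2 :: "quat \<Rightarrow> real" where
  "qnorm2 q = (Re0 q)\<^sup>2 + (Im1 q)\<^sup>2 + (Im2 q)\<^sup>2 + (Im3 q)\<^sup>2"

definition qcnj :: "quat \<Rightarrow> quat" where
  "qcnj q = Quat (Re0 q) (- Im1 q) (- Im2 q) (- Im3 q)"

lemma qnorm2_nonneg [simp]: "0 \<le> qnorm2 q"
  by (simp add: qnorm2_def)

lemma qnorm2_eq_0_iff [simp]: "qnorm2 q = 0 \<longleftrightarrow> q = 0"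
  unfolding qnorm2_def quat_eq_iff quat_sel
  by (smt (verit) zero_le_power2 power_eq_0_iff zero_power2)

lemma qnorm2_mult: "qnorm2 (p * q) = qnorm2 p * qnorm2 q"
  by (simp add: qnorm2_def power2_eq_square algebra_simps)

lemma qcnj_mult_self: "qcnj q * q = qnorm2 q *\<^sub>R 1" "q * qcnj q = qnorm2 q *\<^sub>R 1"
  by (simp_all add: quat_eq_iff qcnj_def qnorm2_def power2_eq_square)

instantiation quat :: division_ring
begin

definition "inverse q = (1 / qnorm2 q) *\<^sub>R qcnj q" for q :: quat
definition "p div q = p * inverse q" for p q :: quat

instance
proof
  fix p q :: quat
  show "p \<noteq> 0 \<Longrightarrow> inverse p * p = 1" and "p \<noteq> 0 \<Longrightarrow> p * inverse p = 1"
    by (simp_all add: inverse_quat_def qcnj_mult_self)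
  show "p div q = p * inverse q"
    by (simp add: divide_quat_def)
  show "inverse (0::quat) = 0"
    by (simp add: inverse_quat_def quat_eq_iff qcnj_def)
qed

end

lemma qnorm2_triangle: "sqrt (qnorm2 (p + q)) \<le> sqrt (qnorm2 p) + sqrt (qnorm2 q)"
proof -
  define f where "f = (\<lambda>q. vector [Re0 q, Im1 q, Im2 q, Im3 q] :: real ^ 4)"
  have 4: "f q $ 1 = Re0 q" "f q $ 2 = Im1 q" "f q $ 3 = Im2 q" "f q $ 4 = Im3 q" for q
    by (simp_all add: f_def vector_def)
  have n: "norm (f q) = sqrt (qnorm2 q)" for q
    unfolding norm_vec_def L2_set_def qnorm2_def by (simp add: sum_4 4)
  have "f (p + q) = f p + f q"
    unfolding vec_eq_iff forall_4 by (simp add: 4)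
  then show ?thesis
    using norm_triangle_ineq [of "f p" "f q"] n by metis
qed

instantiation quat :: real_normed_div_algebra
begin

definition "norm q = sqrt (qnorm2 q)"
definition "sgn q = q /\<^sub>R norm q" for q :: quat
definition "dist p q = norm (p - q)" for p q :: quat
definition [code del]:
  "(uniformity :: (quat \<times> quat) filter) = (INF e\<in>{0 <..}. principal {(x, y). dist x y < e})"
definition [code del]:
  "open (U :: quat set) \<longleftrightarrow> (\<forall>x\<in>U. eventually (\<lambda>(x', y). x' = x \<longrightarrow> y \<in> U) uniformity)"

instance
proof
  fix p q :: quat and r :: real and U :: "quat set"
  show "dist p q = norm (p - q)" by (fact dist_quat_def)
  show "sgn p = p /\<^sub>R norm p" by (fact sgn_quat_def)
  show "(uniformity :: (quat \<times> quat) filter) = (INF e\<in>{0 <..}. principal {(x, y). dist x y < e})"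
    by (fact uniformity_quat_def)
  show "open U \<longleftrightarrow> (\<forall>x\<in>U. eventually (\<lambda>(x', y). x' = x \<longrightarrow> y \<in> U) uniformity)"
    by (fact open_quat_def)
  show "norm p = 0 \<longleftrightarrow> p = 0" by (simp add: norm_quat_def)
  show "norm (p + q) \<le> norm p + norm q" by (simp add: norm_quat_def qnorm2_triangle)
  have "qnorm2 (r *\<^sub>R p) = r\<^sup>2 * qnorm2 p" by (simp add: qnorm2_def algebra_simps)
  then show "norm (r *\<^sub>R p) = \<bar>r\<bar> * norm p" by (simp add: norm_quat_def real_sqrt_mult)
  show "norm (p * q) = norm p * norm q" by (simp add: norm_quat_def qnorm2_mult real_sqrt_mult)
qed

end

definition S2 :: "quat set" where
  "S2 = {I. I\<^sup>2 = -1}"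

definition qexp :: "quat \<Rightarrow> real \<Rightarrow> quat" where
  "qexp I t = of_real (cos t) + I * of_real (sin t)"


section \<open>The group SL(2,H) and its action\<close>

definition mat2 :: "'a::zero \<Rightarrow> 'a \<Rightarrow> 'a \<Rightarrow> 'a \<Rightarrow> 'a^2^2" where
  "mat2 a b c d = vector [vector [a, b], vector [c, d]]"

definition dieudonne :: "quat^2^2 \<Rightarrow> real" where
  "dieudonne A = (let a = A$1$1; b = A$1$2; c = A$2$1; d = A$2$2 in
     if a \<noteq> 0 then norm (a * d - a * c * inverse a * b) else norm (c * b))"

definition SL2H :: "(quat^2^2) set" where
  "SL2H = {A. invertible A \<and> dieudonne A = 1}"

text \<open>The extended quaternions are \<^typ>\<open>quat option\<close>, with \<^const>\<open>None\<close> as the point at infinity.\<close>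

definition moebius :: "quat^2^2 \<Rightarrow> quat option \<Rightarrow> quat option" where
  "moebius A w = (let a = A$1$1; b = A$1$2; c = A$2$1; d = A$2$2 in
     case w of
       None \<Rightarrow> if c = 0 then None else Some (a * inverse c)
     | Some z \<Rightarrow> if c * z + d = 0 then None else Some ((a * z + b) * inverse (c * z + d)))"

definition Hhat :: "quat option topology" where
  "Hhat = Alexandroff_compactification euclidean"

text \<open>A fixed point is attracting if the iterates converge to it pointwise on a neighbourhood, and
  repelling if it is attracting for the inverse.\<close>

definition attracting_fixpoint :: "quat^2^2 \<Rightarrow> quat option \<Rightarrow> bool" where
  "attracting_fixpoint A p \<longleftrightarrow> moebius A p = p \<and>
     (\<exists>U. openin Hhat U \<and> p \<in> U \<and>
          (\<forall>w\<in>U. limitin Hhat (\<lambda>n. (moebius A ^^ n) w) p sequentially))"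

definition repelling_fixpoint :: "quat^2^2 \<Rightarrow> quat option \<Rightarrow> bool" where
  "repelling_fixpoint A q \<longleftrightarrow> attracting_fixpoint (matrix_inv A) q"

definition loxodromic :: "quat^2^2 \<Rightarrow> bool" where
  "loxodromic A \<longleftrightarrow> A \<in> SL2H \<and>
     (\<exists>p q. p \<noteq> q \<and> {w. moebius A w = w} = {p, q} \<and>
            attracting_fixpoint A p \<and> repelling_fixpoint A q)"

definition conj_rel :: "((quat^2^2) \<times> (quat^2^2)) set" where
  "conj_rel = {(A, B). A \<in> SL2H \<and> B \<in> SL2H \<and> (\<exists>P\<in>SL2H. B = P ** A ** matrix_inv P)}"

definition conj_class :: "quat^2^2 \<Rightarrow> (quat^2^2) set" where
  "conj_class A = conj_rel `` {A}"

definition lox_normal_form :: "quat^2^2 \<Rightarrow> real \<times> real \<times> real \<Rightarrow> bool" where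
  "lox_normal_form A = (\<lambda>(r, \<theta>, \<phi>). r > 1 \<and> \<theta> \<in> {0..pi} \<and> \<phi> \<in> {0..pi} \<and>
     (\<exists>I\<in>S2. \<exists>J\<in>S2.
        (A, mat2 (of_real r * qexp I \<theta>) 0 0 (of_real (inverse r) * qexp J \<phi>)) \<in> conj_rel))"

definition lox_params :: "quat^2^2 \<Rightarrow> real \<times> real \<times> real" where
  "lox_params A = (THE p. lox_normal_form A p)"

definition regular_loxodromic :: "quat^2^2 \<Rightarrow> bool" where
  "regular_loxodromic A \<longleftrightarrow> loxodromic A \<and>
     (\<exists>r. \<exists>\<theta>\<in>{0<..<pi}. \<exists>\<phi>\<in>{0<..<pi}. lox_normal_form A (r, \<theta>, \<phi>))"

definition lox_classes :: "(quat^2^2) set set" where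
  "lox_classes = {A. loxodromic A} // conj_rel"

definition reg_classes :: "(quat^2^2) set set" where
  "reg_classes = {A. regular_loxodromic A} // conj_rel"


section \<open>Invariants\<close>

definition trH :: "quat^2^2 \<Rightarrow> real" where
  "trH A = Re0 (A$1$1 + A$2$2)"

definition nu :: "quat^2^2 \<Rightarrow> real" where
  "nu A = (let (r, \<theta>, \<phi>) = lox_params A in r\<^sup>2 + inverse (r\<^sup>2))"

text \<open>With \<open>i j = k\<close>, a quaternion is \<open>z + w j\<close> for the complex numbers \<open>z\<close>, \<open>w\<close> below.\<close>

definition zpart :: "quat \<Rightarrow> complex" where "zpart q = Complex (Re0 q) (Im1 q)"
definition wpart :: "quat \<Rightarrow> complex" where "wpart q = Complex (Im2 q) (Im3 q)"

definition Phi :: "quat^2^2 \<Rightarrow> complex^4^4" where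
  "Phi A = (let a = A$1$1; b = A$1$2; c = A$2$1; d = A$2$2 in vector [
     vector [  zpart a,       wpart a,         zpart b,       wpart b],
     vector [- cnj (wpart a), cnj (zpart a), - cnj (wpart b), cnj (zpart b)],
     vector [  zpart c,       wpart c,         zpart d,       wpart d],
     vector [- cnj (wpart c), cnj (zpart c), - cnj (wpart d), cnj (zpart d)]])"

definition charpolyH :: "quat^2^2 \<Rightarrow> complex poly" where
  "charpolyH A = det (mat [:0, 1:] - map_matrix (\<lambda>z. [:z:]) (Phi A))"

text \<open>The value of a class function on a class; meaningful when \<open>f\<close> is constant on \<open>C\<close>.\<close>

definition on_class :: "(quat^2^2 \<Rightarrow> 'b) \<Rightarrow> (quat^2^2) set \<Rightarrow> 'b" where
  "on_class f C = the_elem (f ` C)"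

definition Theta :: "(quat^2^2) set \<Rightarrow> real \<times> real \<times> real" where
  "Theta = on_class (\<lambda>A. (trH A, trH (matrix_inv A), nu A))"

definition Theta_sq :: "(quat^2^2) set \<Rightarrow> real \<times> real \<times> real" where
  "Theta_sq = on_class (\<lambda>A. (trH A, trH (matrix_inv A), trH (A ** A)))"

definition class_params :: "(quat^2^2) set \<Rightarrow> real \<times> real \<times> real" where
  "class_params = on_class lox_params"

definition param_box :: "(real \<times> real \<times> real) set" where
  "param_box = {1<..} \<times> {0<..<pi} \<times> {0<..<pi}"

text \<open>The topology transported along the coordinates \<open>(r, \<theta>, \<phi>)\<close>.\<close>

definition reg_topology :: "(quat^2^2) set topology" where
  "reg_topology = pullback_topology reg_classes class_params euclidean"


section \<open>Real-analytic maps and the image domain\<close>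

text \<open>Local representation by an (unconditionally) convergent power series in three variables;
  intended for open \<open>S\<close>.\<close>

definition real_analytic_on ::
  "(real \<times> real \<times> real \<Rightarrow> 'b::real_normed_vector) \<Rightarrow> (real \<times> real \<times> real) set \<Rightarrow> bool"
  where
  "real_analytic_on f S \<longleftrightarrow>
     (\<forall>(x, y, z)\<in>S. \<exists>e>0. \<exists>c :: nat \<times> nat \<times> nat \<Rightarrow> 'b.
        \<forall>h1 h2 h3. \<bar>h1\<bar> < e \<longrightarrow> \<bar>h2\<bar> < e \<longrightarrow> \<bar>h3\<bar> < e \<longrightarrow>
          ((\<lambda>(i, j, k). (h1 ^ i * h2 ^ j * h3 ^ k) *\<^sub>R c (i, j, k))
             has_sum f (x + h1, y + h2, z + h3)) UNIV)"

definition u_fun :: "real \<Rightarrow> real \<Rightarrow> real \<Rightarrow> real" where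
  "u_fun x y z = 1/2 * ((x + y) / sqrt (z + 2) + (x - y) / sqrt (z - 2))"

definition v_fun :: "real \<Rightarrow> real \<Rightarrow> real \<Rightarrow> real" where
  "v_fun x y z = 1/2 * ((x + y) / sqrt (z + 2) - (x - y) / sqrt (z - 2))"

definition D_set :: "(real \<times> real \<times> real) set" where
  "D_set = {(x, y, z). z > 2 \<and> \<bar>u_fun x y z\<bar> < 1 \<and> \<bar>v_fun x y z\<bar> < 1}"

end

theory Submission
  imports Defs "HOL-Complex_Analysis.Cauchy_Integral_Formula"
begin

text \<open>
  A loxodromic matrix has two fixed points, that is, two quaternionic eigenvectors. In the basis
  they form the matrix becomes diagonal with entries \<open>a\<close>, \<open>d\<close>, and \<open>|a| |d| = 1\<close>. On the line through
  the fixed points it acts by \<open>\<tau> \<mapsto> d \<tau> a\<^sup>-\<^sup>1\<close>, so attraction at the first point forces \<open>|d| < |a|\<close>.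
  Polar coordinates of the two entries give the normal form (\<open>loxodromic_normal_form\<close>); conversely
  every such diagonal matrix is loxodromic (\<open>diag_loxodromic\<close>). Two unit imaginary quaternions are
  conjugate by a unit quaternion, hence the class depends only on \<open>(r, \<theta>, \<phi>)\<close> (\<open>lox_diag_conj\<close>).

  Traces and the characteristic polynomial are conjugation invariants, so they can be read off the
  normal form. With \<open>c = cos \<theta>\<close> and \<open>d = cos \<phi>\<close>,
  \<open>x = r c + d / r\<close>, \<open>y = c / r + r d\<close>, \<open>z = r\<^sup>2 + r\<^sup>-\<^sup>2\<close>, and the middle coefficient is
  \<open>c\<^sub>2 = z + 4 c d\<close>; since \<open>x y z - x\<^sup>2 - y\<^sup>2 = c d (z\<^sup>2 - 4)\<close> this is the stated formula.
  The number \<open>z\<close> determines \<open>r > 1\<close>, after which \<open>(x, y)\<close> is an invertible linear image of \<open>(c, d)\<close>: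
  this is the injectivity of \<open>\<Theta>\<close>. The triple with \<open>tr (A\<^sup>2)\<close> determines the characteristic
  polynomial, whose roots are \<open>r e\<^bsup>\<plusminus>i\<theta>\<^esup>\<close> and \<open>r\<^sup>-\<^sup>1 e\<^bsup>\<plusminus>i\<phi>\<^esup>\<close>; the roots outside the unit circle give
  \<open>r\<close> and \<open>c\<close> (\<open>charpoly_params_unique\<close>). The same lemma makes the normal form unique.

  On regular classes \<open>\<Theta>\<close> is the map \<open>(r, \<theta>, \<phi>) \<mapsto> (x, y, z)\<close> in coordinates. As
  \<open>z \<plusminus> 2 = (r \<plusminus> r\<^sup>-\<^sup>1)\<^sup>2\<close>, \<open>x + y = (c + d)(r + r\<^sup>-\<^sup>1)\<close> and \<open>x - y = (c - d)(r - r\<^sup>-\<^sup>1)\<close>, it is inverted by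
  \<open>u\<close>, \<open>v\<close> and \<open>r = (\<surd>(z + 2) + \<surd>(z - 2)) / 2\<close>, a continuous map on the whole of \<open>\<D>\<close>.
  Analyticity follows since each coordinate is a sum of products of one-variable analytic functions.
\<close>

section \<open>The determinant of the complex embedding\<close>

lemma mat2_nth [simp]:
  "mat2 a b c d $ 1 $ 1 = a" "mat2 a b c d $ 1 $ 2 = b"
  "mat2 a b c d $ 2 $ 1 = c" "mat2 a b c d $ 2 $ 2 = d"
  by (simp_all add: mat2_def)

lemma matrix_mult_2_nth: "((A :: 'a::semiring_1^2^2) ** B) $ i $ j = A$i$1 * B$1$j + A$i$2 * B$2$j"
  by (simp add: matrix_matrix_mult_def sum_2)

lemma mat2_mult:
  fixes a :: "'a::semiring_1"
  shows "mat2 a b c d ** mat2 a' b' c' d' =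
    mat2 (a * a' + b * c') (a * b' + b * d') (c * a' + d * c') (c * b' + d * d')"
  by (simp add: vec_eq_iff forall_2 matrix_mult_2_nth)

lemma mat_1_eq_mat2: "(mat 1 :: 'a::semiring_1^2^2) = mat2 1 0 0 1"
  by (simp add: vec_eq_iff forall_2 mat_def)

lemma vector_4_nth:
  "(vector [a, b, c, d] :: 'a::zero^4) $ 1 = a" "(vector [a, b, c, d] :: 'a^4) $ 2 = b"
  "(vector [a, b, c, d] :: 'a^4) $ 3 = c" "(vector [a, b, c, d] :: 'a^4) $ 4 = d"
  by (simp_all add: vector_def)

lemma det_4:
  fixes A :: "'a::comm_ring_1^4^4"
  shows "det A =
    A$1$1 * A$2$2 * A$3$3 * A$4$4 - A$1$1 * A$2$2 * A$3$4 * A$4$3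
  - A$1$1 * A$2$3 * A$3$2 * A$4$4 + A$1$1 * A$2$3 * A$3$4 * A$4$2
  + A$1$1 * A$2$4 * A$3$2 * A$4$3 - A$1$1 * A$2$4 * A$3$3 * A$4$2
  - A$1$2 * A$2$1 * A$3$3 * A$4$4 + A$1$2 * A$2$1 * A$3$4 * A$4$3
  + A$1$2 * A$2$3 * A$3$1 * A$4$4 - A$1$2 * A$2$3 * A$3$4 * A$4$1
  - A$1$2 * A$2$4 * A$3$1 * A$4$3 + A$1$2 * A$2$4 * A$3$3 * A$4$1
  + A$1$3 * A$2$1 * A$3$2 * A$4$4 - A$1$3 * A$2$1 * A$3$4 * A$4$2
  - A$1$3 * A$2$2 * A$3$1 * A$4$4 + A$1$3 * A$2$2 * A$3$4 * A$4$1
  + A$1$3 * A$2$4 * A$3$1 * A$4$2 - A$1$3 * A$2$4 * A$3$2 * A$4$1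
  - A$1$4 * A$2$1 * A$3$2 * A$4$3 + A$1$4 * A$2$1 * A$3$3 * A$4$2
  + A$1$4 * A$2$2 * A$3$1 * A$4$3 - A$1$4 * A$2$2 * A$3$3 * A$4$1
  - A$1$4 * A$2$3 * A$3$1 * A$4$2 + A$1$4 * A$2$3 * A$3$2 * A$4$1"
proof -
  have f: "finite {2::4, 3, 4}" "1 \<notin> {2::4, 3, 4}"
    "finite {3::4, 4}" "2 \<notin> {3::4, 4}" "finite {4::4}" "3 \<notin> {4::4}"
    by auto
  show ?thesis
    unfolding det_def UNIV_4
    unfolding sum_over_permutations_insert[OF f(1,2)]
    unfolding sum_over_permutations_insert[OF f(3,4)]
    unfolding sum_over_permutations_insert[OF f(5,6)]
    unfolding permutes_sing
    by (simp add: sign_swap_id permutation_swap_id sign_compose sign_id permutation_compose)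
qed

lemma Phi_nth:
  "Phi A $ 1 $ 1 = zpart (A$1$1)" "Phi A $ 1 $ 2 = wpart (A$1$1)"
  "Phi A $ 1 $ 3 = zpart (A$1$2)" "Phi A $ 1 $ 4 = wpart (A$1$2)"
  "Phi A $ 2 $ 1 = - cnj (wpart (A$1$1))" "Phi A $ 2 $ 2 = cnj (zpart (A$1$1))"
  "Phi A $ 2 $ 3 = - cnj (wpart (A$1$2))" "Phi A $ 2 $ 4 = cnj (zpart (A$1$2))"
  "Phi A $ 3 $ 1 = zpart (A$2$1)" "Phi A $ 3 $ 2 = wpart (A$2$1)"
  "Phi A $ 3 $ 3 = zpart (A$2$2)" "Phi A $ 3 $ 4 = wpart (A$2$2)"
  "Phi A $ 4 $ 1 = - cnj (wpart (A$2$1))" "Phi A $ 4 $ 2 = cnj (zpart (A$2$1))"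
  "Phi A $ 4 $ 3 = - cnj (wpart (A$2$2))" "Phi A $ 4 $ 4 = cnj (zpart (A$2$2))"
  by (simp_all add: Phi_def Let_def vector_4_nth)

text \<open>Because \<open>\<Phi>\<close> is multiplicative, facts about complex determinants transfer to quaternionic matrices;
this replaces any direct computation with the Dieudonne determinant of a product.\<close>

lemma Phi_mult: "Phi (A ** B) = Phi A ** Phi B"
  unfolding vec_eq_iff forall_4 matrix_matrix_mult_def [of "Phi A"]
  by (simp add: sum_4 Phi_nth matrix_mult_2_nth zpart_def wpart_def complex_eq_iff algebra_simps)

lemma Phi_mat_1: "Phi (mat 1) = mat 1"
  by (simp add: vec_eq_iff forall_4 Phi_nth mat_1_eq_mat2 zpart_def wpart_def complex_eq_iff)
     (simp add: mat_def)

text \<open>The square of the Dieudonne determinant written as a polynomial in the real coordinates, which has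
no case distinction on the upper left entry; it is also the determinant of \<open>\<Phi> A\<close>.\<close>

definition reduced_norm :: "quat^2^2 \<Rightarrow> real" where
  "reduced_norm A = qnorm2 (A$1$1) * qnorm2 (A$2$2) + qnorm2 (A$1$2) * qnorm2 (A$2$1)
     - 2 * Re0 (qcnj (A$1$1) * A$1$2 * qcnj (A$2$2) * A$2$1)"

lemma det_Phi: "det (Phi A) = of_real (reduced_norm A)"
  unfolding det_4 Phi_nth reduced_norm_def
  by (simp add: zpart_def wpart_def complex_eq_iff qnorm2_def qcnj_def power2_eq_square)
   (simp add: algebra_simps)

lemma qnorm2_of_real [simp]: "qnorm2 (of_real x) = x\<^sup>2"
  by (simp add: qnorm2_def of_real_def)

lemma norm_quat_power2: "(norm q)\<^sup>2 = qnorm2 q"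
  by (simp add: norm_quat_def)

lemma dieudonne_power2: "(dieudonne A)\<^sup>2 = reduced_norm A"
proof -
  define a b c d where "a = A$1$1" "b = A$1$2" "c = A$2$1" "d = A$2$2"
  show ?thesis
  proof (cases "a = 0")
    case True
    then show ?thesis
      by (simp add: dieudonne_def Let_def reduced_norm_def norm_quat_power2 qnorm2_mult
          flip: a_b_c_d_def)
         (simp add: qcnj_def)
  next
    case False
    define e where "e = c * qcnj a * b"
    have n: "qnorm2 a \<noteq> 0" using False by simp
    have e2: "qnorm2 e = qnorm2 c * qnorm2 a * qnorm2 b"
      by (simp add: e_def qnorm2_mult) (simp add: qnorm2_def qcnj_def)
    \<comment> \<open>Pulling \<open>a\<close> out on the left leaves the Schur complement \<open>d - c a\<^sup>-\<^sup>1 b\<close>, whose norm expands as a quadratic form.\<close>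
    have eq: "a * d - a * c * inverse a * b = a * (d - (1 / qnorm2 a) *\<^sub>R e)"
      by (simp add: e_def inverse_quat_def algebra_simps)
    have diff: "qnorm2 (d - t *\<^sub>R e) = qnorm2 d - 2 * t * Re0 (qcnj d * e) + t\<^sup>2 * qnorm2 e" for t
      by (simp add: qnorm2_def qcnj_def power2_eq_square algebra_simps)
    have cyc: "Re0 (qcnj d * e) = Re0 (qcnj a * b * qcnj d * c)"
      by (simp add: e_def qcnj_def algebra_simps)
    have "(dieudonne A)\<^sup>2 = qnorm2 a * qnorm2 (d - (1 / qnorm2 a) *\<^sub>R e)"
      using False by (simp add: dieudonne_def Let_def norm_quat_power2 eq qnorm2_mult
          flip: a_b_c_d_def)
    also have "\<dots> = reduced_norm A"
      unfolding diff e2 cyc reduced_norm_def a_b_c_d_def[symmetric]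
      using n by (simp add: field_simps power2_eq_square)
    finally show ?thesis .
  qed
qed

lemma dieudonne_nonneg: "0 \<le> dieudonne A"
  by (simp add: dieudonne_def Let_def)

text \<open>Both sides are nonnegative, and their squares are determinants of \<open>\<Phi>\<close>.\<close>

lemma dieudonne_mult: "dieudonne (A ** B) = dieudonne A * dieudonne B"
proof -
  have "complex_of_real (reduced_norm (A ** B)) = of_real (reduced_norm A * reduced_norm B)"
    by (simp add: det_Phi [symmetric] Phi_mult det_mul)
  then have "(dieudonne (A ** B))\<^sup>2 = (dieudonne A * dieudonne B)\<^sup>2"
    unfolding of_real_eq_iff by (simp add: dieudonne_power2 power_mult_distrib)
  then show ?thesis
    by (simp add: dieudonne_nonneg power2_eq_iff_nonneg)
qed

section \<open>The group and its conjugacy relation\<close>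

lemma matrix_inv_eqI:
  fixes A B :: "'a::semiring_1^'n^'n"
  assumes "A ** B = mat 1" "B ** A = mat 1"
  shows "matrix_inv A = B"
proof -
  have "A ** matrix_inv A = mat 1 \<and> matrix_inv A ** A = mat 1"
    unfolding matrix_inv_def
    by (rule someI [where x = B and P = "\<lambda>C. A ** C = mat 1 \<and> C ** A = mat 1"]) (simp add: assms)
  then show ?thesis
    using assms by (metis matrix_mul_assoc matrix_mul_lid matrix_mul_rid)
qed

lemma matrix_inv_inverse:
  fixes A :: "'a::semiring_1^'n^'n"
  assumes "invertible A"
  shows "A ** matrix_inv A = mat 1" "matrix_inv A ** A = mat 1"
proof -
  obtain B where B: "A ** B = mat 1" "B ** A = mat 1"
    using assms by (auto simp: invertible_def)
  then have "matrix_inv A = B" by (rule matrix_inv_eqI)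
  with B show "A ** matrix_inv A = mat 1" "matrix_inv A ** A = mat 1" by simp_all
qed

lemma invertible_matrix_product:
  fixes A B :: "'a::semiring_1^'n^'n"
  assumes "invertible A" "invertible B"
  shows "invertible (A ** B)" "matrix_inv (A ** B) = matrix_inv B ** matrix_inv A"
proof -
  have "A ** B ** (matrix_inv B ** matrix_inv A) = mat 1"
    "matrix_inv B ** matrix_inv A ** (A ** B) = mat 1"
    using assms[THEN matrix_inv_inverse(1)] assms[THEN matrix_inv_inverse(2)]
    by (metis matrix_mul_assoc matrix_mul_rid)+
  then show "invertible (A ** B)" "matrix_inv (A ** B) = matrix_inv B ** matrix_inv A"
    by (auto simp: invertible_def intro: matrix_inv_eqI)
qed

lemma dieudonne_mat_1: "dieudonne (mat 1) = 1"
  by (simp add: dieudonne_def mat_1_eq_mat2)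

lemma SL2H_mat_1: "mat 1 \<in> SL2H"
  by (auto simp: SL2H_def dieudonne_mat_1 invertible_def intro!: exI [of _ "mat 1"])

lemma SL2H_mult: "A \<in> SL2H \<Longrightarrow> B \<in> SL2H \<Longrightarrow> A ** B \<in> SL2H"
  by (simp add: SL2H_def invertible_matrix_product dieudonne_mult)

lemma SL2H_matrix_inv:
  assumes "A \<in> SL2H"
  shows "matrix_inv A \<in> SL2H" "matrix_inv (matrix_inv A) = A"
    "A ** matrix_inv A = mat 1" "matrix_inv A ** A = mat 1"
proof -
  show 1: "A ** matrix_inv A = mat 1" "matrix_inv A ** A = mat 1"
    using assms by (simp_all add: SL2H_def matrix_inv_inverse)
  then show "matrix_inv (matrix_inv A) = A" by (intro matrix_inv_eqI)
  have "dieudonne (matrix_inv A) = 1"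
    using 1(1) dieudonne_mult [of A "matrix_inv A"] assms by (simp add: dieudonne_mat_1 SL2H_def)
  then show "matrix_inv A \<in> SL2H" using 1 by (auto simp: SL2H_def invertible_def)
qed

lemma conj_relI: "A \<in> SL2H \<Longrightarrow> P \<in> SL2H \<Longrightarrow> (A, P ** A ** matrix_inv P) \<in> conj_rel"
  unfolding conj_rel_def by (auto intro!: SL2H_mult SL2H_matrix_inv)

lemma conj_relE:
  assumes "(A, B) \<in> conj_rel"
  obtains P where "A \<in> SL2H" "B \<in> SL2H" "P \<in> SL2H" "B = P ** A ** matrix_inv P"
  using assms by (auto simp: conj_rel_def)

lemma equiv_conj_rel: "equiv SL2H conj_rel"
proof (rule equivI)
  show "conj_rel \<subseteq> SL2H \<times> SL2H"
    by (auto simp: conj_rel_def)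
  show "refl_on SL2H conj_rel"
  proof (rule refl_onI)
    fix A assume "A \<in> SL2H"
    moreover have "matrix_inv (mat 1 :: quat^2^2) = mat 1" by (rule matrix_inv_eqI) auto
    ultimately show "(A, A) \<in> conj_rel"
      using conj_relI [of A "mat 1"] SL2H_mat_1 by simp
  qed
  show "sym conj_rel"
  proof (rule symI)
    fix A B assume "(A, B) \<in> conj_rel"
    then obtain P where P: "A \<in> SL2H" "B \<in> SL2H" "P \<in> SL2H" "B = P ** A ** matrix_inv P"
      by (rule conj_relE)
    have "matrix_inv P ** B ** matrix_inv (matrix_inv P) =
        (matrix_inv P ** P) ** A ** (matrix_inv P ** P)"
      by (simp add: P(4) SL2H_matrix_inv(2) [OF P(3)] matrix_mul_assoc)
    then have "matrix_inv P ** B ** matrix_inv (matrix_inv P) = A"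
      by (simp add: SL2H_matrix_inv(4) P(3))
    then show "(B, A) \<in> conj_rel"
      using conj_relI [of B "matrix_inv P"] P by (simp add: SL2H_matrix_inv)
  qed
  show "trans conj_rel"
  proof (rule transI)
    fix A B C assume AB: "(A, B) \<in> conj_rel" and BC: "(B, C) \<in> conj_rel"
    from AB obtain P where P: "A \<in> SL2H" "B \<in> SL2H" "P \<in> SL2H" "B = P ** A ** matrix_inv P"
      by (rule conj_relE)
    from BC obtain Q where Q: "Q \<in> SL2H" "C = Q ** B ** matrix_inv Q"
      by (rule conj_relE)
    have "C = (Q ** P) ** A ** matrix_inv (Q ** P)"
      using P(3) Q(1) by (simp add: P(4) Q(2) invertible_matrix_product SL2H_def matrix_mul_assoc)
    then show "(A, C) \<in> conj_rel"
      using conj_relI [of A "Q ** P"] P Q by (simp add: SL2H_mult)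
  qed
qed

section \<open>Conjugation invariants\<close>

text \<open>The sums of the diagonal entries of \<open>A B\<close> and of \<open>B A\<close> differ by commutators of quaternions, and
these have real part zero.\<close>

lemma trH_mult_commute: "trH (A ** B) = trH (B ** A)"
  by (simp add: trH_def matrix_mult_2_nth)

lemma trH_conj:
  assumes "P' ** P = mat 1"
  shows "trH (P ** A ** P') = trH A"
proof -
  have "trH (P ** A ** P') = trH (P' ** (P ** A))"
    by (rule trH_mult_commute)
  then show ?thesis by (simp add: matrix_mul_assoc assms)
qed

lemma matrix_mult_diff:
  fixes A :: "'a::ring_1^'n^'m"
  shows "A ** (B - C) = A ** B - A ** C" "(D - E) ** A = D ** A - E ** A"
  by (simp_all add: vec_eq_iff matrix_matrix_mult_def sum_subtractf algebra_simps)

lemma mat_mult_commute: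
  fixes A :: "'a::comm_semiring_1^'n^'n"
  shows "mat x ** A = A ** mat x"
proof -
  have "(\<Sum>k\<in>UNIV. (if i = k then x else 0) * A $ k $ j) = x * A $ i $ j" for i j
    by (simp add: if_distrib [of "\<lambda>y. y * _"] cong: if_cong)
  moreover have "(\<Sum>k\<in>UNIV. A $ i $ k * (if k = j then x else 0)) = x * A $ i $ j" for i j
    by (simp add: if_distrib [of "\<lambda>y. _ * y"] mult.commute cong: if_cong)
  ultimately show ?thesis
    by (simp add: vec_eq_iff matrix_matrix_mult_def mat_def)
qed

abbreviation const_matrix :: "complex^4^4 \<Rightarrow> complex poly^4^4" where
  "const_matrix \<equiv> map_matrix (\<lambda>z. [:z:])"

lemma const_matrix_mult: "const_matrix (M ** N) = const_matrix M ** const_matrix N"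
  by (simp add: vec_eq_iff matrix_matrix_mult_def sum_4 mult.commute)

lemma const_matrix_mat_1: "const_matrix (mat 1) = mat 1"
  by (simp add: vec_eq_iff mat_def)

text \<open>Conjugation by \<open>P\<close> becomes conjugation by the constant matrix \<open>\<Phi> P\<close> over the polynomial ring, and
the scalar matrix of the indeterminate is central there.\<close>

lemma charpolyH_conj:
  assumes "P ** P' = mat 1"
  shows "charpolyH (P ** A ** P') = charpolyH A"
proof -
  let ?p = "const_matrix (Phi P)" and ?p' = "const_matrix (Phi P')" and ?X = "mat [:0, 1:]"
  have 1: "?p ** ?p' = mat 1"
    by (simp flip: const_matrix_mult Phi_mult add: assms Phi_mat_1 const_matrix_mat_1)
  have "?p ** (?X - const_matrix (Phi A)) ** ?p' =
      ?X ** (?p ** ?p') - const_matrix (Phi (P ** A ** P'))"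
    unfolding Phi_mult const_matrix_mult matrix_mult_diff matrix_mul_assoc
    by (simp add: mat_mult_commute)
  then have "charpolyH (P ** A ** P') = det (?p ** (?X - const_matrix (Phi A)) ** ?p')"
    by (simp add: charpolyH_def 1)
  also have "\<dots> = det (?p ** ?p') * charpolyH A"
    by (simp add: det_mul charpolyH_def)
  finally show ?thesis by (simp add: 1)
qed

lemma conj_rel_invariants:
  assumes "(A, B) \<in> conj_rel"
  shows "trH B = trH A" "trH (matrix_inv B) = trH (matrix_inv A)"
    "trH (B ** B) = trH (A ** A)" "charpolyH B = charpolyH A"
proof -
  obtain P where P: "A \<in> SL2H" "P \<in> SL2H" "B = P ** A ** matrix_inv P"
    using assms by (auto elim: conj_relE)
  note PP = SL2H_matrix_inv(3,4) [OF P(2)]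
  show "trH B = trH A" "charpolyH B = charpolyH A"
    unfolding P(3) by (rule trH_conj charpolyH_conj, rule PP)+
  have "P ** A ** (matrix_inv P ** P) ** A ** matrix_inv P = B ** B"
    unfolding P(3) by (simp add: matrix_mul_assoc)
  then have "B ** B = P ** (A ** A) ** matrix_inv P"
    by (simp add: PP matrix_mul_assoc)
  then show "trH (B ** B) = trH (A ** A)"
    by (simp add: trH_conj PP)
  have "matrix_inv B = P ** matrix_inv A ** matrix_inv P"
    using P(1,2) unfolding P(3)
    by (simp add: SL2H_def invertible_matrix_product matrix_mul_assoc
        SL2H_matrix_inv(2) [OF P(2)] matrix_inv_inverse SL2H_matrix_inv(1) [OF P(2), unfolded SL2H_def, simplified])
  then show "trH (matrix_inv B) = trH (matrix_inv A)"
    by (simp add: trH_conj PP)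
qed

section \<open>Unit imaginary quaternions and polar form\<close>

lemma of_real_quat_sel [simp]:
  "Re0 (of_real x) = x" "Im1 (of_real x) = 0" "Im2 (of_real x) = 0" "Im3 (of_real x) = 0"
  by (simp_all add: of_real_def)

lemma S2_iff: "I \<in> S2 \<longleftrightarrow> Re0 I = 0 \<and> (Im1 I)\<^sup>2 + (Im2 I)\<^sup>2 + (Im3 I)\<^sup>2 = 1"
proof
  assume "I \<in> S2"
  then have eq: "I * I = - 1" by (simp add: S2_def power2_eq_square)
  have re: "Re0 I * Re0 I - Im1 I * Im1 I - Im2 I * Im2 I - Im3 I * Im3 I = - 1"
    using arg_cong [OF eq, of Re0] by simp
  have im: "Re0 I * Im1 I = 0" "Re0 I * Im2 I = 0" "Re0 I * Im3 I = 0"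
    using arg_cong [OF eq, of Im1] arg_cong [OF eq, of Im2] arg_cong [OF eq, of Im3]
    by (simp_all add: algebra_simps)
  have "Re0 I = 0"
  proof (rule ccontr)
    assume "Re0 I \<noteq> 0"
    then have "Im1 I = 0" "Im2 I = 0" "Im3 I = 0" using im by simp_all
    then have "Re0 I * Re0 I = - 1" using re by simp
    then show False using zero_le_square [of "Re0 I"] by linarith
  qed
  then show "Re0 I = 0 \<and> (Im1 I)\<^sup>2 + (Im2 I)\<^sup>2 + (Im3 I)\<^sup>2 = 1"
    using re by (simp add: power2_eq_square)
next
  assume "Re0 I = 0 \<and> (Im1 I)\<^sup>2 + (Im2 I)\<^sup>2 + (Im3 I)\<^sup>2 = 1"
  then show "I \<in> S2"
    by (simp add: S2_def quat_eq_iff power2_eq_square algebra_simps)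
qed

lemma qexp_sel [simp]:
  "Re0 (qexp I t) = cos t + Re0 I * sin t" "Im1 (qexp I t) = Im1 I * sin t"
  "Im2 (qexp I t) = Im2 I * sin t" "Im3 (qexp I t) = Im3 I * sin t"
  by (simp_all add: qexp_def)

lemma qnorm2_qexp:
  assumes "I \<in> S2"
  shows "qnorm2 (qexp I t) = 1"
proof -
  have re: "Re0 I = 0" using assms by (simp add: S2_iff)
  have "qnorm2 (qexp I t) = (cos t)\<^sup>2 + ((Im1 I)\<^sup>2 + (Im2 I)\<^sup>2 + (Im3 I)\<^sup>2) * (sin t)\<^sup>2"
    using re by (simp add: qnorm2_def power_mult_distrib distrib_right)
  moreover have "(Im1 I)\<^sup>2 + (Im2 I)\<^sup>2 + (Im3 I)\<^sup>2 = 1" using assms by (simp add: S2_iff)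
  ultimately show ?thesis by simp
qed

lemma qexp_nonzero: "I \<in> S2 \<Longrightarrow> qexp I t \<noteq> 0"
  using qnorm2_qexp [of I t] qnorm2_eq_0_iff [of "qexp I t"] by auto

lemma norm_qexp: "I \<in> S2 \<Longrightarrow> norm (qexp I t) = 1"
  by (simp add: norm_quat_def qnorm2_qexp)

lemma quat_polar:
  fixes q :: quat
  assumes "q \<noteq> 0"
  obtains I \<theta> where "I \<in> S2" "\<theta> \<in> {0..pi}" "q = of_real (norm q) * qexp I \<theta>"
proof -
  define n where "n = norm q"
  define m where "m = sqrt ((Im1 q)\<^sup>2 + (Im2 q)\<^sup>2 + (Im3 q)\<^sup>2)"
  have n: "n > 0" using assms by (simp add: n_def)
  have m2: "m\<^sup>2 = (Im1 q)\<^sup>2 + (Im2 q)\<^sup>2 + (Im3 q)\<^sup>2" by (simp add: m_def)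
  have n2: "n\<^sup>2 = (Re0 q)\<^sup>2 + m\<^sup>2"
    by (simp add: n_def norm_quat_power2 qnorm2_def m2)
  have "(Re0 q / n)\<^sup>2 + (m / n)\<^sup>2 = ((Re0 q)\<^sup>2 + m\<^sup>2) / n\<^sup>2"
    by (simp add: power_divide add_divide_distrib)
  then have "(Re0 q / n)\<^sup>2 + (m / n)\<^sup>2 = 1"
    unfolding n2 [symmetric] using n by simp
  moreover have "m / n \<ge> 0" using n by (simp add: m_def)
  ultimately obtain \<theta> where t: "0 \<le> \<theta>" "\<theta> \<le> pi" "Re0 q / n = cos \<theta>" "m / n = sin \<theta>"
    using sincos_total_pi [of "m / n" "Re0 q / n"] by auto
  define I where "I = (if m = 0 then Quat 0 1 0 0 else
    Quat 0 (Im1 q / m) (Im2 q / m) (Im3 q / m))"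
  have "I \<in> S2"
  proof (cases "m = 0")
    case False
    then show ?thesis
      by (simp add: I_def S2_iff power_divide flip: add_divide_distrib m2)
  qed (simp add: I_def S2_iff)
  moreover have "q = of_real n * qexp I \<theta>"
  proof (cases "m = 0")
    case True
    then have "Im1 q = 0" "Im2 q = 0" "Im3 q = 0"
      using m2 by (simp_all add: add_nonneg_eq_0_iff)
    then show ?thesis using n t True
      by (simp add: quat_eq_iff I_def t(3,4)[symmetric])
  next
    case False
    then show ?thesis using n
      by (simp add: quat_eq_iff I_def t(3,4)[symmetric])
  qed
  ultimately show ?thesis using t(1,2) that n_def by force
qed

text \<open>For every \<open>p\<close> the quaternion \<open>J p + p I\<close> intertwines \<open>I\<close> and \<open>J\<close>, by \<open>I\<^sup>2 = J\<^sup>2 = -1\<close>. It cannot vanish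
for all \<open>p\<close>: the choice \<open>p = 1\<close> would give \<open>J = -I\<close>, and then \<open>I\<close> would commute with every
quaternion, hence be real.\<close>

lemma S2_conjugate:
  assumes "I \<in> S2" "J \<in> S2"
  obtains u where "norm u = 1" "u * I = J * u"
proof -
  have sq: "I * I = - 1" "J * J = - 1" using assms by (simp_all add: S2_def power2_eq_square)
  \<comment> \<open>Testing \<open>p = 1\<close> and the two generators \<open>i\<close>, \<open>j\<close> suffices.\<close>
  have "\<exists>p. J * p + p * I \<noteq> 0"
  proof (rule ccontr)
    assume "\<nexists>p. J * p + p * I \<noteq> 0"
    then have z: "J * p + p * I = 0" for p by blast
    have J: "J = - I" using z [of 1] by (simp add: eq_neg_iff_add_eq_0)
    have "I = 0"
      using z [of "Quat 0 1 0 0"] z [of "Quat 0 0 1 0"] assms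
      unfolding J by (simp add: quat_eq_iff S2_iff)
    then show False using sq by simp
  qed
  then obtain p where p: "J * p + p * I \<noteq> 0" ..
  define w where "w = J * p + p * I"
  have "w * I = J * w"
    by (simp add: w_def distrib_left distrib_right mult.assoc sq)
       (simp add: sq flip: mult.assoc)
  then have "(w /\<^sub>R norm w) * I = J * (w /\<^sub>R norm w)" by simp
  moreover have "norm (w /\<^sub>R norm w) = 1" using p by (simp add: w_def)
  ultimately show ?thesis using that by blast
qed

section \<open>Diagonal normal forms\<close>

definition lox_diag :: "quat \<Rightarrow> quat \<Rightarrow> real \<times> real \<times> real \<Rightarrow> quat^2^2" where
  "lox_diag I J = (\<lambda>(r, \<theta>, \<phi>). mat2 (of_real r * qexp I \<theta>) 0 0 (of_real (inverse r) * qexp J \<phi>))"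

lemma lox_normal_form_iff:
  "lox_normal_form A (r, \<theta>, \<phi>) \<longleftrightarrow> r > 1 \<and> \<theta> \<in> {0..pi} \<and> \<phi> \<in> {0..pi} \<and>
     (\<exists>I\<in>S2. \<exists>J\<in>S2. (A, lox_diag I J (r, \<theta>, \<phi>)) \<in> conj_rel)"
  by (simp add: lox_normal_form_def lox_diag_def)

lemma diag_inverse:
  fixes a d :: quat
  assumes "a \<noteq> 0" "d \<noteq> 0"
  shows "invertible (mat2 a 0 0 d)" "matrix_inv (mat2 a 0 0 d) = mat2 (inverse a) 0 0 (inverse d)"
proof -
  have "mat2 a 0 0 d ** mat2 (inverse a) 0 0 (inverse d) = mat 1"
    "mat2 (inverse a) 0 0 (inverse d) ** mat2 a 0 0 d = mat 1"
    using assms by (simp_all add: mat2_mult mat_1_eq_mat2)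
  then show "invertible (mat2 a 0 0 d)" "matrix_inv (mat2 a 0 0 d) = mat2 (inverse a) 0 0 (inverse d)"
    by (auto simp: invertible_def intro: matrix_inv_eqI)
qed

lemma diag_in_SL2H:
  "norm a * norm d = 1 \<Longrightarrow> mat2 a 0 0 d \<in> SL2H"
  by (auto simp: SL2H_def dieudonne_def Let_def norm_mult intro!: diag_inverse)

lemma lox_diag_in_SL2H:
  assumes "I \<in> S2" "J \<in> S2" "r > 1"
  shows "lox_diag I J (r, \<theta>, \<phi>) \<in> SL2H"
  using assms by (simp add: lox_diag_def norm_mult norm_qexp diag_in_SL2H del: of_real_inverse)

lemma Re0_inverse: "Re0 (inverse q) = Re0 q / qnorm2 q"
  by (simp add: inverse_quat_def qcnj_def)

lemma lox_diag_traces: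
  assumes "I \<in> S2" "J \<in> S2" "r > 1"
  shows "trH (lox_diag I J (r, \<theta>, \<phi>)) = r * cos \<theta> + cos \<phi> / r" (is ?A)
    "trH (matrix_inv (lox_diag I J (r, \<theta>, \<phi>))) = cos \<theta> / r + r * cos \<phi>" (is ?B)
    "trH (lox_diag I J (r, \<theta>, \<phi>) ** lox_diag I J (r, \<theta>, \<phi>)) =
      r\<^sup>2 * (2 * (cos \<theta>)\<^sup>2 - 1) + (2 * (cos \<phi>)\<^sup>2 - 1) / r\<^sup>2" (is ?C)
proof -
  have re: "Re0 I = 0" "Re0 J = 0" using assms by (simp_all add: S2_iff)
  show ?A using re by (simp add: lox_diag_def trH_def divide_inverse del: of_real_inverse)
  have "of_real r * qexp I \<theta> \<noteq> 0" "of_real (inverse r) * qexp J \<phi> \<noteq> 0"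
    using assms by (simp_all add: qexp_nonzero)
  then show ?B using assms re
    by (simp add: lox_diag_def diag_inverse trH_def Re0_inverse qnorm2_mult qnorm2_qexp
        power2_eq_square del: of_real_inverse)
      (simp add: field_simps)
  have sq: "Re0 (q * q) = 2 * (Re0 q)\<^sup>2 - qnorm2 q" for q
    by (simp add: qnorm2_def power2_eq_square)
  show ?C using assms re unfolding lox_diag_def trH_def prod.case
    by (simp add: mat2_mult sq qnorm2_mult qnorm2_qexp  del: of_real_inverse quat_sel(21))
      (simp add: power_mult_distrib field_simps del: of_real_inverse of_real_divide)
qed

text \<open>The matrix is block diagonal under \<open>\<Phi>\<close>, and a block with entries \<open>z\<close>, \<open>w\<close> contributes
\<open>(t - z)(t - cnj z) + w cnj w\<close>, that is, \<open>t\<^sup>2 - 2 Re(a) t + |a|\<^sup>2\<close>.\<close>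

lemma charpolyH_diag:
  "charpolyH (mat2 a 0 0 d) = map_poly of_real
     ([:qnorm2 a, - 2 * Re0 a, 1:] * [:qnorm2 d, - 2 * Re0 d, 1:])"
proof -
  have zero: "zpart 0 = 0" "wpart 0 = 0" by (simp_all add: zpart_def wpart_def Complex_eq_0)
  have neg: "[:- wpart q:] = - [:wpart q:]" "[:- cnj (wpart q):] = - [:cnj (wpart q):]" for q
    by simp_all
  have quad: "[:- z, 1:] * [:- cnj z, 1:] + [:w:] * [:cnj w:] =
     map_poly of_real [:(Re z)\<^sup>2 + (Im z)\<^sup>2 + (Re w)\<^sup>2 + (Im w)\<^sup>2, - 2 * Re z, 1:]" for z w :: complex
    by (simp add: map_poly_pCons complex_eq_iff power2_eq_square)
  have "charpolyH (mat2 a 0 0 d) =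
    ([:- zpart a, 1:] * [:- cnj (zpart a), 1:] + [:wpart a:] * [:cnj (wpart a):]) *
    ([:- zpart d, 1:] * [:- cnj (zpart d), 1:] + [:wpart d:] * [:cnj (wpart d):])"
    unfolding charpolyH_def det_4
    by (simp add: mat_def Phi_nth zero neg del: mult_pCons_left mult_pCons_right minus_pCons)
      (simp add: algebra_simps del: mult_pCons_left mult_pCons_right minus_pCons)
  also have "\<dots> = map_poly of_real
     ([:qnorm2 a, - 2 * Re0 a, 1:] * [:qnorm2 d, - 2 * Re0 d, 1:])"
    unfolding quad
    by (simp add: zpart_def wpart_def qnorm2_def power2_eq_square map_poly_pCons algebra_simps)
  finally show ?thesis .
qed

lemma lox_diag_charpolyH:
  assumes "I \<in> S2" "J \<in> S2" "r > 1"
  shows "charpolyH (lox_diag I J (r, \<theta>, \<phi>)) = map_poly of_real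
    ([:r\<^sup>2, - 2 * (r * cos \<theta>), 1:] * [:inverse (r\<^sup>2), - 2 * (cos \<phi> / r), 1:])"
  using assms unfolding lox_diag_def prod.case charpolyH_diag
  by (simp add: qnorm2_mult qnorm2_qexp S2_iff divide_inverse power_inverse mult.commute del: of_real_inverse)

lemma lox_normal_form_invariants:
  assumes "lox_normal_form A (r, \<theta>, \<phi>)"
  shows "r > 1" "\<theta> \<in> {0..pi}" "\<phi> \<in> {0..pi}"
    "trH A = r * cos \<theta> + cos \<phi> / r"
    "trH (matrix_inv A) = cos \<theta> / r + r * cos \<phi>"
    "trH (A ** A) = r\<^sup>2 * (2 * (cos \<theta>)\<^sup>2 - 1) + (2 * (cos \<phi>)\<^sup>2 - 1) / r\<^sup>2"
    "charpolyH A = map_poly of_real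
      ([:r\<^sup>2, - 2 * (r * cos \<theta>), 1:] * [:inverse (r\<^sup>2), - 2 * (cos \<phi> / r), 1:])"
proof -
  obtain I J where IJ: "I \<in> S2" "J \<in> S2" "(A, lox_diag I J (r, \<theta>, \<phi>)) \<in> conj_rel"
    and r: "r > 1" and ang: "\<theta> \<in> {0..pi}" "\<phi> \<in> {0..pi}"
    using assms by (auto simp: lox_normal_form_iff)
  note inv = conj_rel_invariants [OF IJ(3)] lox_diag_traces [OF IJ(1,2) r]
    lox_diag_charpolyH [OF IJ(1,2) r]
  show "r > 1" "\<theta> \<in> {0..pi}" "\<phi> \<in> {0..pi}" by (fact r ang)+
  show "trH A = r * cos \<theta> + cos \<phi> / r"
    "trH (matrix_inv A) = cos \<theta> / r + r * cos \<phi>"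
    "trH (A ** A) = r\<^sup>2 * (2 * (cos \<theta>)\<^sup>2 - 1) + (2 * (cos \<phi>)\<^sup>2 - 1) / r\<^sup>2"
    "charpolyH A = map_poly of_real
      ([:r\<^sup>2, - 2 * (r * cos \<theta>), 1:] * [:inverse (r\<^sup>2), - 2 * (cos \<phi> / r), 1:])"
    using inv by metis+
qed

text \<open>The roots of \<open>t\<^sup>2 - 2 s c t + s\<^sup>2\<close> are \<open>s e\<^bsup>\<plusminus>i\<theta>\<^esup>\<close> with \<open>cos \<theta> = c\<close>. Thus a single root recovers both \<open>s\<close>
and \<open>c\<close>.\<close>

lemma real_quadratic_root:
  fixes s c :: real and t :: complex
  assumes root: "t\<^sup>2 - 2 * of_real (s * c) * t + of_real (s\<^sup>2) = 0" and c: "\<bar>c\<bar> \<le> 1" and s: "s > 0"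
  shows "Re t = s * c" "cmod t = s"
proof -
  have re: "(Re t)\<^sup>2 - (Im t)\<^sup>2 - 2 * (s * c) * Re t + s\<^sup>2 = 0"
    and im: "Im t * (Re t - s * c) = 0"
    using root by (simp_all add: complex_eq_iff power2_eq_square algebra_simps)
  have c2: "c\<^sup>2 \<le> 1" using c by (simp add: abs_square_le_1)
  show *: "Re t = s * c"
  proof (cases "Im t = 0")
    case True
    then have "(Re t - s * c)\<^sup>2 + s\<^sup>2 * (1 - c\<^sup>2) = 0"
      using re by (simp add: power2_eq_square algebra_simps)
    moreover have "s\<^sup>2 * (1 - c\<^sup>2) \<ge> 0" using c2 by simp
    ultimately have "(Re t - s * c)\<^sup>2 = 0"
      using zero_le_power2 [of "Re t - s * c"] by linarith
    then show ?thesis by simp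
  qed (use im in simp)
  have "(cmod t)\<^sup>2 = s\<^sup>2"
    using re unfolding cmod_power2 * by (simp add: power2_eq_square algebra_simps)
  then show "cmod t = s" using s by (simp add: power2_eq_iff_nonneg)
qed

text \<open>The linear system for \<open>(c, d)\<close> has determinant \<open>r\<^sup>2 - r\<^sup>-\<^sup>2\<close>, which is positive for \<open>r > 1\<close>.\<close>

lemma linear_params_unique:
  fixes r c d c' d' :: real
  assumes "r > 1" "r * c + d / r = r * c' + d' / r" "c / r + r * d = c' / r + r * d'"
  shows "c = c'" "d = d'"
proof -
  have r: "r * r > 1" using assms(1) by (simp add: less_1_mult)
  have e1: "r * r * (c - c') = d' - d" "r * r * (d - d') = c' - c"
    using assms by (simp_all add: field_simps)
  have "(r * r * (r * r) - 1) * (c - c') = r * r * (r * r * (c - c')) - (c - c')"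
    by (simp add: algebra_simps)
  also have "\<dots> = 0" unfolding e1(1) using e1(2) by (simp add: algebra_simps)
  finally have "(r * r * (r * r) - 1) * (c - c') = 0" .
  moreover have "r * r * (r * r) > 1" using r by (simp add: less_1_mult)
  ultimately show c: "c = c'" by simp
  show "d = d'" using e1 c by simp
qed

text \<open>The three hypotheses say that the polynomials
\<open>(t\<^sup>2 - 2 r c t + r\<^sup>2)(t\<^sup>2 - 2 r\<^sup>-\<^sup>1 d t + r\<^sup>-\<^sup>2)\<close> of the two parameter triples coincide. A root of modulus
\<open>r > 1\<close> of the first cannot come from the second factor of the other one, whose roots lie inside the
unit disc, so it comes from the factor with \<open>r'\<close> and \<open>c'\<close>.\<close>

lemma charpoly_params_unique:
  fixes r c d r' c' d' :: real
  assumes r: "r > 1" "r' > 1"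
    and c: "\<bar>c\<bar> \<le> 1" "\<bar>c'\<bar> \<le> 1" and d: "\<bar>d'\<bar> \<le> 1"
    and x: "r * c + d / r = r' * c' + d' / r'"
    and y: "c / r + r * d = c' / r' + r' * d'"
    and z: "r\<^sup>2 + inverse (r\<^sup>2) + 4 * c * d = r'\<^sup>2 + inverse (r'\<^sup>2) + 4 * c' * d'"
  shows "r = r'" "c = c'" "d = d'"
proof -
  define Q where "Q s c t = t\<^sup>2 - 2 * of_real (s * c) * t + of_real (s\<^sup>2)" for s c :: real and t :: complex
  have prod: "Q s c t * Q (inverse s) d t =
      t^4 - 2 * of_real (s * c + d / s) * t^3 + of_real (s\<^sup>2 + inverse (s\<^sup>2) + 4 * c * d) * t\<^sup>2
      - 2 * of_real (c / s + s * d) * t + 1"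
    if "s > 1" for s c d t
    using that unfolding Q_def
    by (simp add: field_simps power2_eq_square eval_nat_numeral)
  define t where "t = Complex (r * c) (r * sqrt (1 - c\<^sup>2))"
  have "1 - c\<^sup>2 \<ge> 0" using c by (simp add: abs_square_le_1)
  then have "sqrt (1 - c\<^sup>2) * sqrt (1 - c\<^sup>2) = 1 - c * c"
    by (simp add: power2_eq_square)
  then have root: "Q r c t = 0"
    unfolding Q_def t_def by (simp add: complex_eq_iff power2_eq_square algebra_simps)
  have t: "Re t = r * c" "cmod t = r"
    using real_quadratic_root [of t r c] root r c by (simp_all add: Q_def)
  have "Q r' c' t * Q (inverse r') d' t = Q r c t * Q (inverse r) d t"
    using r x y z by (simp only: prod)
  then have "Q r' c' t = 0 \<or> Q (inverse r') d' t = 0" using root by simp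
  moreover have "Q (inverse r') d' t \<noteq> 0"
  proof
    assume "Q (inverse r') d' t = 0"
    then have "cmod t = inverse r'"
      using real_quadratic_root [of t "inverse r'" d'] r d by (simp add: Q_def)
    then have "r = inverse r'" using t by simp
    moreover have "inverse r' < 1" using r by (simp add: field_simps)
    ultimately show False using r by simp
  qed
  ultimately have "Q r' c' t = 0" by simp
  then have t': "Re t = r' * c'" "cmod t = r'"
    using real_quadratic_root [of t r' c'] r c by (simp_all add: Q_def)
  show "r = r'" using t t' by simp
  then show "c = c'" "d = d'" using linear_params_unique [of r c d c' d'] x y r by simp_all
qed

text \<open>The function \<open>s \<mapsto> s + s\<^sup>-\<^sup>1\<close> is injective for \<open>s > 1\<close>; here \<open>s = r\<^sup>2\<close>.\<close>

lemma trace_params_unique: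
  fixes r c d r' c' d' :: real
  assumes r: "r > 1" "r' > 1"
    and x: "r * c + d / r = r' * c' + d' / r'"
    and y: "c / r + r * d = c' / r' + r' * d'"
    and z: "r\<^sup>2 + inverse (r\<^sup>2) = r'\<^sup>2 + inverse (r'\<^sup>2)"
  shows "r = r'" "c = c'" "d = d'"
proof -
  have "(r\<^sup>2 - r'\<^sup>2) * (r\<^sup>2 * r'\<^sup>2 - 1) = 0"
    using z r by (simp add: field_simps power2_eq_square)
  moreover have "r\<^sup>2 * r'\<^sup>2 > 1" using r by (simp add: less_1_mult power2_eq_square)
  ultimately have "r\<^sup>2 = r'\<^sup>2" by simp
  then show eq: "r = r'" using r by (simp add: power2_eq_iff_nonneg)
  then show "c = c'" "d = d'" using linear_params_unique [of r c d c' d'] x y r by simp_all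
qed

text \<open>Newton's identity for the roots: twice the trace of \<open>A\<^sup>2\<close> is their power sum \<open>(2 x)\<^sup>2 - 2 c\<^sub>2\<close>.\<close>

lemma second_coefficient_of_trace:
  fixes r c d :: real
  assumes "r > 1"
  shows "2 * (r * c + d / r)\<^sup>2 - (r\<^sup>2 * (2 * c\<^sup>2 - 1) + (2 * d\<^sup>2 - 1) / r\<^sup>2)
     = r\<^sup>2 + inverse (r\<^sup>2) + 4 * c * d"
  using assms by (simp add: field_simps power2_eq_square)

lemma lox_normal_forms_eqI:
  assumes "lox_normal_form A p" "lox_normal_form B p'"
    and "trH A = trH B" "trH (matrix_inv A) = trH (matrix_inv B)" "trH (A ** A) = trH (B ** B)"
  shows "p = p'"
proof -
  obtain r \<theta> \<phi> r' \<theta>' \<phi>' where p: "p = (r, \<theta>, \<phi>)" "p' = (r', \<theta>', \<phi>')" by (metis surj_pair)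
  note A = lox_normal_form_invariants [OF assms(1) [unfolded p]]
  note B = lox_normal_form_invariants [OF assms(2) [unfolded p]]
  have z: "r\<^sup>2 + inverse (r\<^sup>2) + 4 * cos \<theta> * cos \<phi> = r'\<^sup>2 + inverse (r'\<^sup>2) + 4 * cos \<theta>' * cos \<phi>'"
    using assms(3,5) second_coefficient_of_trace [OF A(1), of "cos \<theta>" "cos \<phi>"]
      second_coefficient_of_trace [OF B(1), of "cos \<theta>'" "cos \<phi>'"]
    unfolding A(4,6) B(4,6) by simp
  have "r = r'" "cos \<theta> = cos \<theta>'" "cos \<phi> = cos \<phi>'"
    using charpoly_params_unique [of r r' "cos \<theta>" "cos \<theta>'" "cos \<phi>'" "cos \<phi>"] z assms(3,4)
    by (simp_all add: A(1,4,5) B(1,4,5))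
  then show ?thesis using A(2,3) B(2,3) cos_inj_pi p by simp
qed

lemma lox_normal_form_unique:
  assumes "lox_normal_form A p"
  shows "\<exists>!p. lox_normal_form A p" "lox_params A = p"
proof -
  show 1: "\<exists>!p. lox_normal_form A p" using assms lox_normal_forms_eqI by metis
  show "lox_params A = p" unfolding lox_params_def using 1 assms by (rule the1_equality)
qed

lemma conj_rel_sym_iff: "(A, B) \<in> conj_rel \<longleftrightarrow> (B, A) \<in> conj_rel"
  using equiv_conj_rel by (meson equivE symE)

lemma conj_rel_trans: "(A, B) \<in> conj_rel \<Longrightarrow> (B, C) \<in> conj_rel \<Longrightarrow> (A, C) \<in> conj_rel"
  using equiv_conj_rel by (meson equivE transE)

lemma lox_normal_form_conj:
  assumes "(A, B) \<in> conj_rel"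
  shows "lox_normal_form B p \<longleftrightarrow> lox_normal_form A p"
proof (cases p)
  case (fields r \<theta> \<phi>)
  then show ?thesis
    using assms unfolding fields lox_normal_form_iff by (meson conj_rel_sym_iff conj_rel_trans)
qed

text \<open>Conjugation by a diagonal matrix of unit quaternions rotates the two imaginary directions
independently, so only the real parameters survive in the conjugacy class.\<close>

lemma lox_diag_conj:
  assumes "I \<in> S2" "J \<in> S2" "I' \<in> S2" "J' \<in> S2" "r > 1"
  shows "(lox_diag I J (r, \<theta>, \<phi>), lox_diag I' J' (r, \<theta>, \<phi>)) \<in> conj_rel"
proof -
  obtain u where u: "norm u = 1" "u * I = I' * u" using S2_conjugate assms by metis
  obtain v where v: "norm v = 1" "v * J = J' * v" using S2_conjugate assms by metis
  define P where "P = mat2 u 0 0 v"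
  have nz: "u \<noteq> 0" "v \<noteq> 0" using u v by auto
  have twist: "w * (of_real s * qexp K t) * inverse w = of_real s * qexp K' t"
    if "w \<noteq> 0" "w * K = K' * w" for w K K' s t
  proof -
    have e: "of_real s * qexp K t = (s * cos t) *\<^sub>R 1 + (s * sin t) *\<^sub>R K" for K
      by (simp add: quat_eq_iff algebra_simps)
    have "w * (of_real s * qexp K t) = (of_real s * qexp K' t) * w"
      unfolding e using that(2) by (simp add: algebra_simps)
    then show ?thesis using that(1) by (simp add: mult.assoc)
  qed
  have "P \<in> SL2H" unfolding P_def using u v by (intro diag_in_SL2H) simp
  moreover have "P ** lox_diag I J (r, \<theta>, \<phi>) ** matrix_inv P = lox_diag I' J' (r, \<theta>, \<phi>)"
    unfolding P_def diag_inverse [OF nz] lox_diag_def prod.case mat2_mult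
    using twist [OF nz(1) u(2)] twist [OF nz(2) v(2)] by (simp del: of_real_inverse)
  ultimately show ?thesis
    using conj_relI [OF lox_diag_in_SL2H [OF assms(1,2,5)], of P] by metis
qed

lemma lox_normal_form_imp_conj:
  assumes "lox_normal_form A p" "lox_normal_form B p"
  shows "(A, B) \<in> conj_rel"
proof (cases p)
  case (fields r \<theta> \<phi>)
  then show ?thesis
    using assms unfolding fields lox_normal_form_iff
    by (meson conj_rel_sym_iff conj_rel_trans lox_diag_conj)
qed

lemma lox_normal_formI:
  assumes "(A, mat2 a 0 0 d) \<in> conj_rel" "norm d < norm a"
  obtains p where "lox_normal_form A p"
proof -
  have "mat2 a 0 0 d \<in> SL2H" using assms by (auto elim: conj_relE)
  then have ad: "norm a * norm d = 1"
    by (simp add: SL2H_def dieudonne_def Let_def norm_mult split: if_splits)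
  then have nz: "a \<noteq> 0" "d \<noteq> 0" and d: "norm d = inverse (norm a)"
    by (auto simp: inverse_unique)
  have "1 < norm a"
  proof (rule ccontr)
    assume "\<not> 1 < norm a"
    then have "norm a * norm d \<le> 1 * norm d" by (intro mult_right_mono) auto
    then show False using ad assms(2) \<open>\<not> 1 < norm a\<close> by linarith
  qed
  moreover obtain I \<theta> where "I \<in> S2" "\<theta> \<in> {0..pi}" "a = of_real (norm a) * qexp I \<theta>"
    using quat_polar [OF nz(1)] .
  moreover obtain J \<phi> where "J \<in> S2" "\<phi> \<in> {0..pi}" "d = of_real (inverse (norm a)) * qexp J \<phi>"
    using quat_polar [OF nz(2)] unfolding d .
  ultimately have "lox_normal_form A (norm a, \<theta>, \<phi>)"
    unfolding lox_normal_form_iff lox_diag_def prod.case using assms(1) by metis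
  then show ?thesis using that by blast
qed

section \<open>The projective line and existence of the normal form\<close>

text \<open>Points of the extended quaternions are lines in the right vector space \<open>H\<^sup>2\<close>: matrices act on the
left, scalars on the right. The column \<open>hcol w\<close> represents the point \<open>w\<close>, and \<open>proj\<close> sends a nonzero
column to its point.\<close>

definition right_scale :: "quat^2 \<Rightarrow> quat \<Rightarrow> quat^2" where
  "right_scale v \<kappa> = (\<chi> i. v $ i * \<kappa>)"

definition hcol :: "quat option \<Rightarrow> quat^2" where
  "hcol w = (case w of None \<Rightarrow> vector [1, 0] | Some z \<Rightarrow> vector [z, 1])"

definition proj :: "quat^2 \<Rightarrow> quat option" where
  "proj v = (if v $ 2 = 0 then None else Some (v $ 1 * inverse (v $ 2)))"

lemma right_scale_nth [simp]: "right_scale v \<kappa> $ i = v $ i * \<kappa>"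
  by (simp add: right_scale_def)

lemma hcol_nth [simp]:
  "hcol None $ 1 = 1" "hcol None $ 2 = 0" "hcol (Some z) $ 1 = z" "hcol (Some z) $ 2 = 1"
  by (simp_all add: hcol_def)

lemma matrix_vector_2_nth [simp]: "((A :: quat^2^2) *v v) $ i = A$i$1 * v$1 + A$i$2 * v$2"
  by (simp add: matrix_vector_mult_def sum_2)

lemma moebius_eq_proj: "moebius A w = proj (A *v hcol w)"
  by (cases w) (simp_all add: moebius_def proj_def Let_def)

lemma proj_right_scale: "\<kappa> \<noteq> 0 \<Longrightarrow> proj (right_scale v \<kappa>) = proj v"
  by (simp add: proj_def nonzero_inverse_mult_distrib)
     (metis mult.assoc right_inverse mult.right_neutral)

lemma hcol_proj:
  assumes "v \<noteq> 0"
  obtains \<kappa> where "\<kappa> \<noteq> 0" "v = right_scale (hcol (proj v)) \<kappa>"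
proof (cases "v $ 2 = 0")
  case True
  then have "v $ 1 \<noteq> 0" using assms by (auto simp: vec_eq_iff forall_2)
  moreover have "v = right_scale (hcol (proj v)) (v $ 1)"
    using True by (simp add: vec_eq_iff forall_2 proj_def)
  ultimately show ?thesis using that by blast
next
  case False
  then have "v = right_scale (hcol (proj v)) (v $ 2)"
    by (simp add: vec_eq_iff forall_2 proj_def mult.assoc)
  then show ?thesis using False that by blast
qed

lemma mult_right_scale: "(A :: quat^2^2) *v right_scale v \<kappa> = right_scale (A *v v) \<kappa>"
  by (simp add: vec_eq_iff algebra_simps)

lemma moebius_proj: "v \<noteq> 0 \<Longrightarrow> moebius A (proj v) = proj (A *v v)"
  by (metis hcol_proj moebius_eq_proj mult_right_scale proj_right_scale)

lemma hcol_nonzero: "hcol w \<noteq> 0"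
  by (cases w) (simp_all add: vec_eq_iff forall_2)

text \<open>A fixed point is an invariant line; the eigenvalue is nonzero by invertibility of \<open>A\<close>. It is only
determined up to conjugation, but with the representative \<open>hcol w\<close> fixed it is a definite
quaternion, and only its norm matters below.\<close>

lemma fixpoint_eigenvector:
  assumes "A \<in> SL2H" "moebius A w = w"
  obtains \<kappa> where "\<kappa> \<noteq> 0" "A *v hcol w = right_scale (hcol w) \<kappa>"
proof -
  have "matrix_inv A *v (A *v hcol w) = hcol w"
    by (simp add: matrix_vector_mul_assoc SL2H_matrix_inv(4) [OF assms(1)] del: matrix_vector_2_nth)
  then have "A *v hcol w \<noteq> 0" using hcol_nonzero by (metis matrix_vector_mult_0_right)
  then show ?thesis using hcol_proj assms(2) that unfolding moebius_eq_proj by metis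
qed

lemma hcol_independent:
  assumes "p \<noteq> q" "right_scale (hcol p) \<alpha> + right_scale (hcol q) \<beta> = 0"
  shows "\<alpha> = 0"
proof -
  have e: "hcol p $ 1 * \<alpha> + hcol q $ 1 * \<beta> = 0" "hcol p $ 2 * \<alpha> + hcol q $ 2 * \<beta> = 0"
    using assms(2) by (simp_all add: vec_eq_iff)
  show ?thesis
  proof (cases p)
    case None
    then show ?thesis using e assms(1) by (cases q) auto
  next
    case p: (Some x)
    show ?thesis
    proof (cases q)
      case None
      then show ?thesis using e p by simp
    next
      case (Some y)
      then have e': "x * \<alpha> + y * \<beta> = 0" "\<alpha> + \<beta> = 0" using e p by simp_all
      then have "\<beta> = - \<alpha>" by (simp add: eq_neg_iff_add_eq_0 add.commute)
      with e'(1) have "(x - y) * \<alpha> = 0" by (simp add: left_diff_distrib)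
      then show ?thesis using Some p assms(1) by simp
    qed
  qed
qed

text \<open>An affine coordinate on the projective line: \<open>\<tau> = 0\<close> is \<open>p\<close>, and the remaining point \<open>q\<close> is at infinity.\<close>

definition line_point :: "quat option \<Rightarrow> quat option \<Rightarrow> quat \<Rightarrow> quat option" where
  "line_point p q \<tau> = proj (hcol p + right_scale (hcol q) \<tau>)"

text \<open>In the coordinate adapted to two fixed points the action is linear, with norm factor \<open>|\<mu>| / |\<kappa>|\<close>.\<close>

lemma moebius_line_point:
  assumes "p \<noteq> q" "\<kappa> \<noteq> 0"
    and "A *v hcol p = right_scale (hcol p) \<kappa>" "A *v hcol q = right_scale (hcol q) \<mu>"
  shows "moebius A (line_point p q \<tau>) = line_point p q (\<mu> * \<tau> * inverse \<kappa>)"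
proof -
  have one: "right_scale v 1 = v" for v by (simp add: vec_eq_iff)
  have nz: "hcol p + right_scale (hcol q) \<tau> \<noteq> 0"
    using hcol_independent [OF assms(1), of 1 \<tau>] by (auto simp: one)
  have "A *v (hcol p + right_scale (hcol q) \<tau>)
      = right_scale (hcol p) \<kappa> + right_scale (right_scale (hcol q) \<mu>) \<tau>"
    by (simp add: matrix_vector_right_distrib mult_right_scale assms(3,4) del: matrix_vector_2_nth)
  also have "\<dots> = right_scale (hcol p + right_scale (hcol q) (\<mu> * \<tau> * inverse \<kappa>)) \<kappa>"
    using assms(2) by (simp add: vec_eq_iff distrib_right mult.assoc)
  finally show ?thesis
    unfolding line_point_def using moebius_proj [OF nz, of A] proj_right_scale [OF assms(2)] by simp
qed

lemma line_point_Some: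
  "line_point (Some x) None \<tau> = Some (x + \<tau>)"
  "\<tau> \<noteq> - 1 \<Longrightarrow> line_point (Some x) (Some y) \<tau> = Some (x + (y - x) * \<tau> * inverse (1 + \<tau>))"
  "line_point (Some x) (Some y) (- 1) = None"
proof -
  assume "\<tau> \<noteq> - 1"
  then have nz: "1 + \<tau> \<noteq> 0" by (metis add.commute eq_neg_iff_add_eq_0)
  have "x + y * \<tau> = x * (1 + \<tau>) + (y - x) * \<tau>" by (simp add: algebra_simps)
  then have "(x + y * \<tau>) * inverse (1 + \<tau>) = x * (1 + \<tau>) * inverse (1 + \<tau>) + (y - x) * \<tau> * inverse (1 + \<tau>)"
    by (simp only: distrib_right)
  then show "line_point (Some x) (Some y) \<tau> = Some (x + (y - x) * \<tau> * inverse (1 + \<tau>))"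
    using nz by (simp add: line_point_def proj_def mult.assoc)
qed (simp_all add: line_point_def proj_def)

lemma line_point_near:
  assumes "open V" "x \<in> V"
  obtains t where "t > 0" "line_point (Some x) q (of_real t) \<in> Some ` V"
proof -
  obtain e where e: "e > 0" "ball x e \<subseteq> V" using assms by (meson open_contains_ball)
  define C where "C = (case q of None \<Rightarrow> 1 | Some y \<Rightarrow> norm (y - x) + 1)"
  have C: "C > 0" by (cases q) (auto simp: C_def add_nonneg_pos)
  define t where "t = e / (2 * C)"
  have t: "t > 0" "t * C < e" using e C by (simp_all add: t_def)
  have "\<exists>\<omega>. line_point (Some x) q (of_real t) = Some \<omega> \<and> norm (\<omega> - x) \<le> t * C"
  proof (cases q)
    case None
    then show ?thesis using t by (simp add: line_point_Some C_def)
  next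
    case (Some y)
    have "1 + of_real t = (of_real (1 + t) :: quat)" by simp
    then have n: "norm (1 + of_real t :: quat) = 1 + t"
      using t by (simp only: norm_of_real)
    have "(of_real t :: quat) \<noteq> - 1" using n t by auto
    moreover have "norm (y - x) * t / (1 + t) \<le> t * (norm (y - x) + 1)"
    proof -
      have "norm (y - x) * t / (1 + t) \<le> norm (y - x) * t"
        using t mult_left_mono [of 1 "1 + t" "norm (y - x) * t"] by (simp add: divide_le_eq)
      also have "\<dots> \<le> t * (norm (y - x) + 1)" using t by (simp add: algebra_simps)
      finally show ?thesis .
    qed
    ultimately show ?thesis
      using Some t by (simp add: line_point_Some C_def norm_mult norm_inverse n divide_inverse)
  qed
  then obtain \<omega> where "line_point (Some x) q (of_real t) = Some \<omega>" "norm (\<omega> - x) < e"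
    using t by fastforce
  moreover from this have "\<omega> \<in> V" using e(2) by (auto simp: dist_norm norm_minus_commute)
  ultimately show ?thesis using that [OF t(1)] by simp
qed

lemma line_point_far:
  assumes "t > 0" "q \<noteq> Some x"
  obtains \<delta> where "\<delta> > 0"
    "\<And>\<tau> \<omega>. t \<le> norm \<tau> \<Longrightarrow> line_point (Some x) q \<tau> = Some \<omega> \<Longrightarrow> \<delta> \<le> norm (\<omega> - x)"
proof (cases q)
  case None
  show ?thesis
    by (rule that [OF assms(1)]) (auto simp: None line_point_Some)
next
  case (Some y)
  define m where "m = norm (y - x)"
  have m: "m > 0" using Some assms by (auto simp: m_def)
  show ?thesis
  proof (rule that [of "m * (t / (1 + t))"])
    show "0 < m * (t / (1 + t))" using m assms(1) by simp
    fix \<tau> \<omega> assume t: "t \<le> norm \<tau>" and eq: "line_point (Some x) q \<tau> = Some \<omega>"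
    have ne: "\<tau> \<noteq> - 1" using eq Some by (auto simp: line_point_Some)
    then have nz: "1 + \<tau> \<noteq> 0" by (metis add.commute eq_neg_iff_add_eq_0)
    have "norm (1 + \<tau>) \<le> 1 + norm \<tau>" using norm_triangle_ineq [of 1 \<tau>] by simp
    then have "norm \<tau> / (1 + norm \<tau>) \<le> norm \<tau> / norm (1 + \<tau>)"
      using nz by (intro divide_left_mono) (simp_all add: add_pos_nonneg)
    moreover have "t / (1 + t) \<le> norm \<tau> / (1 + norm \<tau>)"
      using t assms(1) by (simp add: field_simps)
    ultimately have "m * (t / (1 + t)) \<le> m * (norm \<tau> / norm (1 + \<tau>))"
      using m by (intro mult_left_mono) auto
    also have "\<dots> = norm (\<omega> - x)"
      using eq Some ne by (auto simp: line_point_Some norm_mult norm_inverse m_def divide_inverse)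
    finally show "m * (t / (1 + t)) \<le> norm (\<omega> - x)" .
  qed
qed

lemma open_Some_vimage: "openin Hhat U \<Longrightarrow> open (Some -` U)"
  using openin_continuous_map_preimage [OF continuous_map_Some, of euclidean U]
  by (simp add: Hhat_def vimage_def)

lemma openin_Hhat_Some: "open V \<Longrightarrow> openin Hhat (Some ` V)"
  by (simp add: Hhat_def)

text \<open>If \<open>|\<kappa>| \<le> |\<mu>|\<close>, the linear coordinate \<open>\<tau>\<close> never shrinks under iteration, so the orbit of a point other than
the fixed point stays at a definite distance from it (\<open>line_point_far\<close>), although such starting points
exist in every neighbourhood (\<open>line_point_near\<close>). Taking the attracting point finite keeps the
estimate within the metric of \<open>H\<close>.\<close>

lemma attracting_eigenvalue:
  assumes att: "attracting_fixpoint A (Some x)" and "q \<noteq> Some x" "\<kappa> \<noteq> 0"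
    and eig: "A *v hcol (Some x) = right_scale (hcol (Some x)) \<kappa>" "A *v hcol q = right_scale (hcol q) \<mu>"
  shows "norm \<mu> < norm \<kappa>"
proof (rule ccontr)
  assume "\<not> norm \<mu> < norm \<kappa>"
  then have ge: "norm \<kappa> \<le> norm \<mu>" by simp
  obtain U where U: "openin Hhat U" "Some x \<in> U"
    "\<And>w. w \<in> U \<Longrightarrow> limitin Hhat (\<lambda>n. (moebius A ^^ n) w) (Some x) sequentially"
    using att unfolding attracting_fixpoint_def by blast
  obtain t where t: "t > 0" "line_point (Some x) q (of_real t) \<in> Some ` (Some -` U)"
    using line_point_near [OF open_Some_vimage [OF U(1)], of x q] U(2) by auto
  define T where "T \<tau> = \<mu> * \<tau> * inverse \<kappa>" for \<tau>
  have iter: "(moebius A ^^ n) (line_point (Some x) q \<tau>) = line_point (Some x) q ((T ^^ n) \<tau>)" for n \<tau>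
    by (induction n) (use moebius_line_point [OF _ assms(3) eig] assms(2) in \<open>auto simp: T_def\<close>)
  have grow: "norm \<tau> \<le> norm (T \<tau>)" for \<tau>
  proof -
    have "norm (T \<tau>) = norm \<mu> * norm \<tau> / norm \<kappa>"
      by (simp add: T_def norm_mult norm_inverse divide_inverse)
    then show ?thesis
      using assms(3) mult_right_mono [OF ge, of "norm \<tau>"] by (simp add: pos_le_divide_eq mult.commute)
  qed
  have far: "t \<le> norm ((T ^^ n) (of_real t))" for n
    by (induction n) (use t grow in \<open>auto intro: order_trans\<close>)
  obtain \<delta> where \<delta>: "\<delta> > 0"
    "\<And>\<tau> \<omega>. t \<le> norm \<tau> \<Longrightarrow> line_point (Some x) q \<tau> = Some \<omega> \<Longrightarrow> \<delta> \<le> norm (\<omega> - x)"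
    using line_point_far [OF t(1) assms(2)] by blast
  have "limitin Hhat (\<lambda>n. (moebius A ^^ n) (line_point (Some x) q (of_real t))) (Some x) sequentially"
    using t(2) by (intro U(3)) auto
  moreover have "openin Hhat (Some ` ball x \<delta>)" "Some x \<in> Some ` ball x \<delta>"
    using \<delta>(1) by (auto intro: openin_Hhat_Some)
  ultimately have "\<forall>\<^sub>F n in sequentially. (moebius A ^^ n) (line_point (Some x) q (of_real t)) \<in> Some ` ball x \<delta>"
    by (simp add: limitin_def)
  then obtain n where "(moebius A ^^ n) (line_point (Some x) q (of_real t)) \<in> Some ` ball x \<delta>"
    using eventually_happens'[OF sequentially_bot] by blast
  then obtain \<omega> where "line_point (Some x) q ((T ^^ n) (of_real t)) = Some \<omega>" "norm (\<omega> - x) < \<delta>"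
    unfolding iter by (auto simp: dist_norm norm_minus_commute)
  then show False using \<delta>(2) [OF far] by force
qed

lemma inverse_eigenvector:
  assumes "A \<in> SL2H" "\<kappa> \<noteq> 0" "A *v v = right_scale v \<kappa>"
  shows "matrix_inv A *v v = right_scale v (inverse \<kappa>)"
proof -
  have "matrix_inv A *v right_scale v \<kappa> = v"
    by (simp add: assms(3) [symmetric] matrix_vector_mul_assoc SL2H_matrix_inv(4) [OF assms(1)]
        del: matrix_vector_2_nth)
  then have "right_scale (right_scale (matrix_inv A *v v) \<kappa>) (inverse \<kappa>) = right_scale v (inverse \<kappa>)"
    by (simp add: mult_right_scale)
  then show ?thesis using assms(2) by (simp add: vec_eq_iff mult.assoc del: matrix_vector_2_nth)
qed

text \<open>The points \<open>p\<close> and \<open>q\<close> are distinct, so their columns are independent. In the case of two finite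
points the inverse is a quaternionic Cramer rule with \<open>k = (x - y)\<^sup>-\<^sup>1\<close>.\<close>

lemma invertible_hcols:
  assumes "p \<noteq> q"
  shows "invertible (mat2 (hcol p $ 1) (hcol q $ 1) (hcol p $ 2) (hcol q $ 2))"
proof -
  have inv: "invertible P" if "P ** Q = mat2 1 0 0 1" "Q ** P = mat2 1 0 0 1" for P Q :: "quat^2^2"
    using that by (auto simp: invertible_def mat_1_eq_mat2)
  show ?thesis
  proof (cases p)
    case None
    then obtain y where "q = Some y" using assms by (cases q) auto
    then show ?thesis unfolding None
      by (intro inv [of _ "mat2 1 (- y) 0 1"]) (simp_all add: mat2_mult)
  next
    case p: (Some x)
    show ?thesis
    proof (cases q)
      case None
      then show ?thesis unfolding p
        by (intro inv [of _ "mat2 0 1 1 (- x)"]) (simp_all add: mat2_mult)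
    next
      case (Some y)
      define k where "k = inverse (x - y)"
      have k: "k * (x - y) = 1" "(x - y) * k = 1" using Some p assms by (simp_all add: k_def)
      have k': "k * x = 1 + k * y" "x * k = 1 + y * k" using k by (simp_all add: algebra_simps)
      have k'': "x * (k * y) = y + y * (k * y)" "y * (k * x) = y + y * (k * y)"
        by (simp_all add: k' distrib_left distrib_right flip: mult.assoc)
      show ?thesis unfolding p Some
        by (intro inv [of _ "mat2 k (- (k * y)) (- k) (k * x)"])
           (simp_all add: mat2_mult k' k'' algebra_simps)
    qed
  qed
qed

text \<open>The matrix of eigenvectors diagonalizes \<open>A\<close>. To conjugate inside \<open>SL(2,H)\<close> its second column is scaled
by a real number, which normalizes the determinant and, being central, leaves the eigenvalue
unchanged.\<close>

lemma eigenvectors_diagonalize: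
  assumes A: "A \<in> SL2H" and "p \<noteq> q"
    and eig: "A *v hcol p = right_scale (hcol p) \<kappa>" "A *v hcol q = right_scale (hcol q) \<mu>"
  shows "(A, mat2 \<kappa> 0 0 \<mu>) \<in> conj_rel"
proof -
  define P0 where "P0 = mat2 (hcol p $ 1) (hcol q $ 1) (hcol p $ 2) (hcol q $ 2)"
  have P0: "invertible P0" unfolding P0_def by (rule invertible_hcols [OF assms(2)])
  have "dieudonne P0 * dieudonne (matrix_inv P0) = 1"
    by (simp add: matrix_inv_inverse [OF P0] dieudonne_mat_1 flip: dieudonne_mult)
  then have d: "dieudonne P0 > 0" using dieudonne_nonneg [of P0] by (cases "dieudonne P0 = 0") auto
  define S where "S = mat2 1 0 0 (of_real (inverse (dieudonne P0)) :: quat)"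
  have S: "invertible S" "dieudonne S = inverse (dieudonne P0)"
    unfolding S_def using d by (auto intro: diag_inverse simp: dieudonne_def simp del: of_real_inverse)
  define P where "P = P0 ** S"
  have P: "P \<in> SL2H"
    using d by (simp add: SL2H_def P_def invertible_matrix_product P0 S dieudonne_mult)
  have eqs: "A $ i $ 1 * hcol p $ 1 + A $ i $ 2 * hcol p $ 2 = hcol p $ i * \<kappa>"
    "A $ i $ 1 * hcol q $ 1 + A $ i $ 2 * hcol q $ 2 = hcol q $ i * \<mu>" for i
    using eig by (simp_all add: vec_eq_iff)
  have "A ** P0 = P0 ** mat2 \<kappa> 0 0 \<mu>"
    by (simp add: vec_eq_iff forall_2 matrix_mult_2_nth P0_def eqs)
  moreover have "mat2 \<kappa> 0 0 \<mu> ** S = S ** mat2 \<kappa> 0 0 \<mu>"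
    by (simp add: S_def mat2_mult of_real_def del: of_real_inverse)
  ultimately have AP: "A ** P = P ** mat2 \<kappa> 0 0 \<mu>"
    by (simp add: P_def matrix_mul_assoc) (simp flip: matrix_mul_assoc)
  have "matrix_inv P ** A ** matrix_inv (matrix_inv P) = matrix_inv P ** (A ** P)"
    by (simp add: SL2H_matrix_inv(2) [OF P] matrix_mul_assoc)
  also have "\<dots> = mat2 \<kappa> 0 0 \<mu>"
    by (simp add: AP matrix_mul_assoc SL2H_matrix_inv(4) [OF P])
  finally show ?thesis using conj_relI [OF A SL2H_matrix_inv(1) [OF P]] by simp
qed

text \<open>One of the two fixed points is finite. If it is the attracting one, \<open>attracting_eigenvalue\<close> applies
directly; otherwise it is the repelling one, and the same lemma applied to the inverse matrix gives
the same inequality.\<close>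

lemma loxodromic_normal_form:
  assumes "loxodromic A"
  obtains p where "lox_normal_form A p"
proof -
  obtain p q where A: "A \<in> SL2H" and "p \<noteq> q" and "{w. moebius A w = w} = {p, q}"
    and p: "attracting_fixpoint A p" and q: "attracting_fixpoint (matrix_inv A) q"
    using assms by (auto simp: loxodromic_def repelling_fixpoint_def)
  then have fix_pt: "moebius A p = p" "moebius A q = q" by blast+
  obtain \<kappa> where l: "\<kappa> \<noteq> 0" "A *v hcol p = right_scale (hcol p) \<kappa>"
    using fixpoint_eigenvector [OF A fix_pt(1)] .
  obtain \<mu> where m: "\<mu> \<noteq> 0" "A *v hcol q = right_scale (hcol q) \<mu>"
    using fixpoint_eigenvector [OF A fix_pt(2)] .
  have "norm \<mu> < norm \<kappa>"
  proof (cases p)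
    case (Some x)
    then show ?thesis using attracting_eigenvalue [of A x q \<kappa> \<mu>] p \<open>p \<noteq> q\<close> l m by auto
  next
    case None
    then obtain y where y: "q = Some y" using \<open>p \<noteq> q\<close> by (cases q) auto
    \<comment> \<open>The roles of the two fixed points are exchanged for the inverse matrix.\<close>
    have "norm (inverse \<kappa>) < norm (inverse \<mu>)"
      using attracting_eigenvalue [of "matrix_inv A" y p "inverse \<mu>" "inverse \<kappa>"]
        q \<open>p \<noteq> q\<close> y l m inverse_eigenvector [OF A l] inverse_eigenvector [OF A m] by simp
    then show ?thesis using l m by (simp add: norm_inverse)
  qed
  then show ?thesis
    using lox_normal_formI [OF eigenvectors_diagonalize [OF A \<open>p \<noteq> q\<close> l(2) m(2)]] that by blast
qed

lemma moebius_diag: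
  assumes "d \<noteq> 0"
  shows "moebius (mat2 a 0 0 d) None = None" "moebius (mat2 a 0 0 d) (Some z) = Some (a * z * inverse d)"
  using assms by (simp_all add: moebius_def)

lemma moebius_diag_iterate:
  assumes "d \<noteq> 0"
  shows "(moebius (mat2 a 0 0 d) ^^ n) None = None"
    "\<exists>\<omega>. (moebius (mat2 a 0 0 d) ^^ n) (Some z) = Some \<omega> \<and> norm \<omega> = (norm a / norm d) ^ n * norm z"
  by (induction n) (use assms in \<open>auto simp: moebius_diag norm_mult norm_inverse divide_inverse\<close>)

lemma attracting_diag_zero:
  assumes "norm a < norm d"
  shows "attracting_fixpoint (mat2 a 0 0 d) (Some 0)"
proof -
  have d: "d \<noteq> 0" using assms by auto
  have "limitin Hhat (\<lambda>n. (moebius (mat2 a 0 0 d) ^^ n) (Some z)) (Some 0) sequentially" for z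
    unfolding limitin_def
  proof (intro conjI allI impI)
    show "Some 0 \<in> topspace Hhat" by (simp add: Hhat_def)
    fix U assume U: "openin Hhat U \<and> Some 0 \<in> U"
    then obtain e where e: "e > 0" "ball 0 e \<subseteq> Some -` U"
      using open_Some_vimage by (metis open_contains_ball vimageI)
    have "(\<lambda>n. (norm a / norm d) ^ n * norm z) \<longlonglongrightarrow> 0"
      using assms d by (intro tendsto_mult_left_zero LIMSEQ_power_zero) simp
    then have "\<forall>\<^sub>F n in sequentially. (norm a / norm d) ^ n * norm z < e"
      using e(1) by (rule order_tendstoD)
    then show "\<forall>\<^sub>F n in sequentially. (moebius (mat2 a 0 0 d) ^^ n) (Some z) \<in> U"
    proof eventually_elim
      case (elim n)
      obtain \<omega> where \<omega>: "(moebius (mat2 a 0 0 d) ^^ n) (Some z) = Some \<omega>"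
        "norm \<omega> = (norm a / norm d) ^ n * norm z"
        using moebius_diag_iterate(2) [OF d] by metis
      then have "\<omega> \<in> ball 0 e" using elim by simp
      then show ?case using \<omega>(1) e(2) by auto
    qed
  qed
  moreover have "openin Hhat (Some ` UNIV)" by (rule openin_Hhat_Some) simp
  ultimately show ?thesis
    unfolding attracting_fixpoint_def using d
    by (auto simp: moebius_diag intro!: exI [of _ "Some ` UNIV"])
qed

text \<open>Neighbourhoods of infinity are complements of compact sets, hence contain everything of large norm;
all points but \<open>0\<close> have orbits whose norm grows geometrically.\<close>

lemma attracting_diag_infinity:
  assumes "norm d < norm a" "d \<noteq> 0"
  shows "attracting_fixpoint (mat2 a 0 0 d) None"
proof -
  have lim: "limitin Hhat (\<lambda>n. (moebius (mat2 a 0 0 d) ^^ n) w) None sequentially" if "w \<noteq> Some 0" for w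
    unfolding limitin_def
  proof (intro conjI allI impI)
    show "None \<in> topspace Hhat" by (simp add: Hhat_def)
    fix U assume U: "openin Hhat U \<and> None \<in> U"
    then obtain C where C: "compact C" "U = insert None (Some ` (- C))"
      by (auto simp: Hhat_def openin_Alexandroff_compactification Compl_eq_Diff_UNIV)
    show "\<forall>\<^sub>F n in sequentially. (moebius (mat2 a 0 0 d) ^^ n) w \<in> U"
    proof (cases w)
      case None
      then show ?thesis using U assms(2) by (simp add: moebius_diag_iterate)
    next
      case (Some z)
      obtain B where B: "B > 0" "\<And>c. c \<in> C \<Longrightarrow> norm c \<le> B"
        using compact_imp_bounded [OF C(1)] by (auto simp: bounded_pos)
      have z: "norm z > 0" using that Some by simp
      have "(\<lambda>n. inverse ((norm a / norm d) ^ n)) \<longlonglongrightarrow> 0"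
        using assms by (intro LIMSEQ_inverse_realpow_zero) simp
      moreover have "norm z / B > 0" using z B(1) by simp
      ultimately have "\<forall>\<^sub>F n in sequentially. inverse ((norm a / norm d) ^ n) < norm z / B"
        by (rule order_tendstoD)
      then show ?thesis
      proof eventually_elim
        case (elim n)
        have k: "(norm a / norm d) ^ n > 0" using assms by (auto intro!: zero_less_power divide_pos_pos)
        have "B < (norm a / norm d) ^ n * norm z"
        proof -
          have "inverse ((norm a / norm d) ^ n) * ((norm a / norm d) ^ n * B)
              < norm z / B * ((norm a / norm d) ^ n * B)"
            using elim k B(1) by (intro mult_strict_right_mono) simp_all
          moreover have "inverse ((norm a / norm d) ^ n) * ((norm a / norm d) ^ n * B) = B"
            using k by (metis less_irrefl left_inverse mult.assoc mult_1_left)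
          moreover have "norm z / B * ((norm a / norm d) ^ n * B) = (norm a / norm d) ^ n * norm z"
            using B(1) by simp
          ultimately show ?thesis by simp
        qed
        moreover obtain \<omega> where "(moebius (mat2 a 0 0 d) ^^ n) (Some z) = Some \<omega>"
          "norm \<omega> = (norm a / norm d) ^ n * norm z"
          using moebius_diag_iterate(2) [OF assms(2)] by metis
        ultimately show ?case using B(2) [of \<omega>] C(2) Some by force
      qed
    qed
  qed
  have "openin Hhat (insert None (Some ` (UNIV - {0})))"
    unfolding Hhat_def openin_Alexandroff_compactification
    by (rule disjI2, rule exI [of _ "{0}"]) simp
  then show ?thesis
    unfolding attracting_fixpoint_def using assms(2) lim
    by (auto simp: moebius_diag intro!: exI [of _ "insert None (Some ` (UNIV - {0}))"])
qed

lemma diag_loxodromic: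
  assumes "norm a * norm d = 1" "norm d < norm a"
  shows "loxodromic (mat2 a 0 0 d)"
proof -
  have nz: "a \<noteq> 0" "d \<noteq> 0" using assms by auto
  have "{w. moebius (mat2 a 0 0 d) w = w} = {None, Some 0}"
  proof (intro equalityI subsetI)
    fix w assume w: "w \<in> {w. moebius (mat2 a 0 0 d) w = w}"
    show "w \<in> {None, Some 0}"
    proof (cases w)
      case (Some z)
      then have "a * z * inverse d = z" using w nz by (simp add: moebius_diag)
      then have "a * z * inverse d * d = z * d" by simp
      then have "a * z = z * d" using nz by (simp add: mult.assoc)
      then have "norm a * norm z = norm z * norm d" by (metis norm_mult)
      then show ?thesis using assms(2) Some by simp
    qed simp
  qed (use nz in \<open>auto simp: moebius_diag\<close>)
  moreover have "repelling_fixpoint (mat2 a 0 0 d) (Some 0)"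
    unfolding repelling_fixpoint_def diag_inverse(2) [OF nz]
    using assms nz by (intro attracting_diag_zero) (simp add: norm_inverse)
  ultimately show ?thesis
    unfolding loxodromic_def
    using diag_in_SL2H [OF assms(1)] attracting_diag_infinity [OF assms(2) nz(2)] by blast
qed

lemma lox_diag_loxodromic:
  assumes "I \<in> S2" "J \<in> S2" "r > 1"
  shows "loxodromic (lox_diag I J (r, \<theta>, \<phi>))"
  unfolding lox_diag_def prod.case
proof (rule diag_loxodromic)
  have n: "norm (of_real r * qexp I \<theta>) = r" "norm (of_real (inverse r) * qexp J \<phi>) = inverse r"
    using assms by (simp_all add: norm_mult norm_qexp del: of_real_inverse)
  show "norm (of_real r * qexp I \<theta>) * norm (of_real (inverse r) * qexp J \<phi>) = 1"
    unfolding n using assms by simp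
  have "inverse r < 1" using assms by (simp add: field_simps)
  then show "norm (of_real (inverse r) * qexp J \<phi>) < norm (of_real r * qexp I \<theta>)"
    unfolding n using assms by simp
qed

section \<open>The invariants as functions of the parameters\<close>

definition param_map :: "real \<times> real \<times> real \<Rightarrow> real \<times> real \<times> real" where
  "param_map = (\<lambda>(r, \<theta>, \<phi>).
     (r * cos \<theta> + cos \<phi> / r, cos \<theta> / r + r * cos \<phi>, r\<^sup>2 + inverse (r\<^sup>2)))"

definition param_inv :: "real \<times> real \<times> real \<Rightarrow> real \<times> real \<times> real" where
  "param_inv = (\<lambda>(x, y, z).
     (1/2 * (sqrt (z + 2) + sqrt (z - 2)), arccos (u_fun x y z), arccos (v_fun x y z)))"

lemma sqrt_nu:
  fixes r :: real
  assumes "r > 1"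
  shows "sqrt (r\<^sup>2 + inverse (r\<^sup>2) + 2) = r + inverse r"
    "sqrt (r\<^sup>2 + inverse (r\<^sup>2) - 2) = r - inverse r" "r - inverse r > 0"
proof -
  have "inverse r < 1" using assms by (simp add: field_simps)
  then show gt: "r - inverse r > 0" using assms by linarith
  have "r\<^sup>2 + inverse (r\<^sup>2) + 2 = (r + inverse r)\<^sup>2" "r\<^sup>2 + inverse (r\<^sup>2) - 2 = (r - inverse r)\<^sup>2"
    using assms by (simp_all add: power2_sum power2_diff power_inverse)
  then show "sqrt (r\<^sup>2 + inverse (r\<^sup>2) + 2) = r + inverse r"
    "sqrt (r\<^sup>2 + inverse (r\<^sup>2) - 2) = r - inverse r"
    using assms gt by (simp_all add: add_nonneg_nonneg)
qed

text \<open>The two square roots are \<open>r + r\<^sup>-\<^sup>1\<close> and \<open>r - r\<^sup>-\<^sup>1\<close>, while \<open>x + y\<close> and \<open>x - y\<close> are these same numbers times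
\<open>c + d\<close> and \<open>c - d\<close>.\<close>

lemma param_map_inverts:
  fixes r :: real
  assumes "r > 1" "(x, y, z) = (r * c + d / r, c / r + r * d, r\<^sup>2 + inverse (r\<^sup>2))"
  shows "z > 2" "1/2 * (sqrt (z + 2) + sqrt (z - 2)) = r" "u_fun x y z = c" "v_fun x y z = d"
proof -
  have z: "sqrt (z + 2) = r + inverse r" "sqrt (z - 2) = r - inverse r"
    and gt: "r - inverse r > 0" "r + inverse r > 0"
    using sqrt_nu [OF assms(1)] assms by (auto intro: add_pos_pos)
  have "sqrt (z - 2) > 0" using gt z by simp
  then show "z > 2" by simp
  show "1/2 * (sqrt (z + 2) + sqrt (z - 2)) = r" by (simp add: z)
  have "x + y = (c + d) * (r + inverse r)" "x - y = (c - d) * (r - inverse r)"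
    using assms by (simp_all add: algebra_simps divide_inverse)
  then have "(x + y) / sqrt (z + 2) = c + d" "(x - y) / sqrt (z - 2) = c - d"
    using gt by (simp_all add: z)
  then show "u_fun x y z = c" "v_fun x y z = d" by (simp_all add: u_fun_def v_fun_def)
qed

lemma param_map_in_D_set:
  assumes "p \<in> param_box"
  shows "param_map p \<in> D_set" "param_inv (param_map p) = p"
proof -
  obtain r \<theta> \<phi> where p: "p = (r, \<theta>, \<phi>)" "r > 1" "0 < \<theta>" "\<theta> < pi" "0 < \<phi>" "\<phi> < pi"
    using assms by (auto simp: param_box_def)
  have cos_bound: "\<bar>cos t\<bar> < 1" if "0 < t" "t < pi" for t
    using that cos_monotone_0_pi [of 0 t] cos_monotone_0_pi [of t pi] by (auto simp: abs_less_iff)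
  obtain x y z where xyz: "param_map p = (x, y, z)" by (cases "param_map p") auto
  note inv = param_map_inverts [OF p(2), of x y z "cos \<theta>" "cos \<phi>"]
  show "param_map p \<in> D_set" "param_inv (param_map p) = p"
    using inv xyz p cos_bound unfolding p(1)
    by (auto simp: param_map_def D_set_def param_inv_def arccos_cos)
qed

text \<open>With \<open>s = \<surd>(z + 2)\<close> and \<open>w = \<surd>(z - 2)\<close> one has \<open>s\<^sup>2 - w\<^sup>2 = 4\<close>, so \<open>(s - w) / 2\<close> is the inverse of
\<open>r = (s + w) / 2\<close>.\<close>

lemma param_inv_in_param_box:
  assumes "q \<in> D_set"
  shows "param_inv q \<in> param_box" "param_map (param_inv q) = q"
proof -
  obtain x y z where q: "q = (x, y, z)" "z > 2" "\<bar>u_fun x y z\<bar> < 1" "\<bar>v_fun x y z\<bar> < 1"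
    using assms by (auto simp: D_set_def)
  define s w where "s = sqrt (z + 2)" and "w = sqrt (z - 2)"
  have s: "s > 2" unfolding s_def using q(2) by (intro real_less_rsqrt) simp
  have w: "w > 0" using q(2) by (simp add: w_def)
  have sq: "s\<^sup>2 = z + 2" "w\<^sup>2 = z - 2" using q(2) by (simp_all add: s_def w_def)
  define r where "r = 1/2 * (s + w)"
  have r: "r > 1" using s w by (simp add: r_def)
  have "r * (1/2 * (s - w)) = 1"
    using sq by (simp add: r_def power2_eq_square algebra_simps)
  then have ri: "inverse r = 1/2 * (s - w)" by (rule inverse_unique)
  have "arccos t \<in> {0<..<pi}" if "\<bar>t\<bar> < 1" for t
    using that arccos_lt_bounded by (auto simp: abs_less_iff)
  then show "param_inv q \<in> param_box"
    using q r by (simp add: param_inv_def param_box_def r_def s_def w_def)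
  have u: "u_fun x y z = 1/2 * ((x + y) / s + (x - y) / w)"
    and v: "v_fun x y z = 1/2 * ((x + y) / s - (x - y) / w)"
    by (simp_all add: u_fun_def v_fun_def s_def w_def)
  have "r * u_fun x y z + inverse r * v_fun x y z = x" "inverse r * u_fun x y z + r * v_fun x y z = y"
  proof -
    define P M where "P = (x + y) / s" and "M = (x - y) / w"
    have PM: "P * s = x + y" "M * w = x - y" using s w by (simp_all add: P_def M_def)
    have "r * u_fun x y z + inverse r * v_fun x y z = 1/2 * (P * s + M * w)"
      "inverse r * u_fun x y z + r * v_fun x y z = 1/2 * (P * s - M * w)"
      unfolding u v ri unfolding r_def P_def [symmetric] M_def [symmetric] by (simp_all add: field_simps)
    then show "r * u_fun x y z + inverse r * v_fun x y z = x"
      "inverse r * u_fun x y z + r * v_fun x y z = y"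
      unfolding PM by simp_all
  qed
  moreover have "r\<^sup>2 + (inverse r)\<^sup>2 = z"
  proof -
    have "(1/2 * (s + w))\<^sup>2 + (1/2 * (s - w))\<^sup>2 = (s\<^sup>2 + w\<^sup>2) / 2"
      by (simp add: power2_eq_square field_simps)
    then show ?thesis unfolding ri unfolding r_def sq by simp
  qed
  moreover have "param_inv q = (r, arccos (u_fun x y z), arccos (v_fun x y z))"
    by (simp add: param_inv_def q(1) r_def s_def w_def)
  moreover have "cos (arccos (u_fun x y z)) = u_fun x y z" "cos (arccos (v_fun x y z)) = v_fun x y z"
    using q by (simp_all add: cos_arccos_abs)
  ultimately show "param_map (param_inv q) = q"
    by (simp add: param_map_def q(1) divide_inverse power_inverse mult.commute)
qed

lemma param_map_bij_betw: "bij_betw param_map param_box D_set"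
  by (rule bij_betw_byWitness [where f' = param_inv])
     (auto simp: param_map_in_D_set param_inv_in_param_box)

lemma open_param_box: "open param_box"
  by (simp add: param_box_def open_Times)

lemma continuous_on_uv:
  "continuous_on {(x, y, z). z > 2} (\<lambda>(x, y, z). u_fun x y z)"
  "continuous_on {(x, y, z). z > 2} (\<lambda>(x, y, z). v_fun x y z)"
  unfolding u_fun_def v_fun_def case_prod_unfold
  by (intro continuous_intros; force)+

lemma open_D_set: "open D_set"
proof -
  let ?H = "{(x :: real, y :: real, z :: real). z > 2}"
  have H: "open ?H"
    unfolding case_prod_unfold by (intro open_Collect_less continuous_intros)
  have "D_set = (?H \<inter> (\<lambda>(x, y, z). u_fun x y z) -` {-1<..<1}) \<inter> (?H \<inter> (\<lambda>(x, y, z). v_fun x y z) -` {-1<..<1})"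
    by (auto simp: D_set_def abs_less_iff)
  moreover have "open \<dots>"
    by (intro open_Int continuous_open_preimage continuous_on_uv H open_greaterThanLessThan)
  ultimately show ?thesis by simp
qed

lemma continuous_on_param_map: "continuous_on param_box param_map"
  unfolding param_map_def case_prod_unfold param_box_def
  by (intro continuous_intros) auto

lemma continuous_on_param_inv: "continuous_on D_set param_inv"
proof -
  have "D_set \<subseteq> {(x, y, z). z > 2}" by (auto simp: D_set_def)
  then have "continuous_on D_set (\<lambda>(x, y, z). u_fun x y z)" "continuous_on D_set (\<lambda>(x, y, z). v_fun x y z)"
    using continuous_on_uv continuous_on_subset by blast+
  then show ?thesis
    unfolding param_inv_def case_prod_unfold
    by (intro continuous_intros) (auto simp: D_set_def abs_less_iff)
qed

section \<open>Real analyticity of the parameter map\<close>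

definition has_power_series :: "(real \<Rightarrow> real) \<Rightarrow> real \<Rightarrow> bool" where
  "has_power_series f x \<longleftrightarrow>
     (\<exists>e>0. \<exists>c. \<forall>h. \<bar>h\<bar> < e \<longrightarrow> ((\<lambda>n. h ^ n * c n) has_sum f (x + h)) UNIV)"

text \<open>A holomorphic function has an absolutely convergent Taylor series on its disc; its real part along
the real axis is then an unconditionally convergent real power series. All the one-variable functions
needed below arise in this way.\<close>

lemma has_power_series_holomorphic:
  assumes hol: "f holomorphic_on ball (of_real x) e" and "e > 0"
    and eq: "\<And>t. \<bar>t - x\<bar> < e \<Longrightarrow> g t = Re (f (of_real t))"
  shows "has_power_series g x"
proof -
  define a where "a n = (deriv ^^ n) f (of_real x) / fact n" for n
  have sums: "(\<lambda>n. a n * of_real h ^ n) sums f (of_real (x + h))" if "\<bar>h\<bar> < e" for h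
  proof -
    have "complex_of_real (x + h) \<in> ball (of_real x) e"
      using that by (simp add: dist_norm flip: of_real_diff)
    from holomorphic_power_series [OF hol this] show ?thesis by (simp add: a_def)
  qed
  have "((\<lambda>n. h ^ n * Re (a n)) has_sum g (x + h)) UNIV" if h: "\<bar>h\<bar> < e" for h
  proof -
    \<comment> \<open>Convergence at a point of larger modulus makes the series at \<open>h\<close> absolutely convergent.\<close>
    define K where "K = (\<bar>h\<bar> + e) / 2"
    have K: "\<bar>h\<bar> < K" "\<bar>K\<bar> < e" using h by (auto simp: K_def)
    have "summable (\<lambda>n. norm (a n * of_real h ^ n))"
      by (rule powser_insidea [OF sums_summable [OF sums [OF K(2)]]]) (use K in simp)
    then have "((\<lambda>n. a n * of_real h ^ n) has_sum f (of_real (x + h))) UNIV"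
      using sums [OF h] by (rule norm_summable_imp_has_sum)
    then have "((\<lambda>n. Re (a n * of_real h ^ n)) has_sum Re (f (of_real (x + h)))) UNIV"
      by (rule has_sum_Re)
    then show ?thesis using eq [of "x + h"] h by (simp add: mult.commute flip: of_real_power)
  qed
  then show ?thesis
    unfolding has_power_series_def using \<open>e > 0\<close>
    by (intro exI [of _ e] conjI exI [of _ "\<lambda>n. Re (a n)"]) simp_all
qed

lemma has_power_series_cos: "has_power_series cos x"
  by (rule has_power_series_holomorphic [where f = cos and e = 1])
     (auto intro!: holomorphic_intros simp flip: cos_of_real)

lemma has_power_series_const: "has_power_series (\<lambda>_. k) x"
  by (rule has_power_series_holomorphic [where f = "\<lambda>_. of_real k" and e = 1])
     (auto intro!: holomorphic_intros)

lemma has_power_series_power: "has_power_series (\<lambda>t. t ^ k) x"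
  by (rule has_power_series_holomorphic [where f = "\<lambda>t. t ^ k" and e = 1])
     (auto intro!: holomorphic_intros simp flip: of_real_power)

lemma has_power_series_inverse_power:
  assumes "x > 0"
  shows "has_power_series (\<lambda>t. inverse (t ^ k)) x"
proof (rule has_power_series_holomorphic [where f = "\<lambda>t. inverse (t ^ k)" and e = x])
  show "(\<lambda>t. inverse (t ^ k)) holomorphic_on ball (complex_of_real x) x"
    using assms by (intro holomorphic_intros) (auto simp: dist_norm)
qed (use assms in \<open>auto simp flip: of_real_power of_real_inverse\<close>)

text \<open>Unconditional convergence of real series is absolute convergence, which is what makes the double
series summable and lets it be evaluated row by row.\<close>

lemma has_sum_product_real:
  fixes f :: "'a \<Rightarrow> real" and g :: "'b \<Rightarrow> real"
  assumes f: "(f has_sum a) A" and g: "(g has_sum b) B"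
  shows "((\<lambda>(i, j). f i * g j) has_sum a * b) (A \<times> B)"
proof (rule has_sum_SigmaI [where g = "\<lambda>i. f i * b"])
  show "((\<lambda>j. case (i, j) of (i, j) \<Rightarrow> f i * g j) has_sum f i * b) B" for i
    using g by (simp add: has_sum_cmult_right)
  show "((\<lambda>i. f i * b) has_sum a * b) A" using f by (rule has_sum_cmult_left)
  have "(\<lambda>i. \<bar>f i\<bar>) summable_on A" "(\<lambda>j. \<bar>g j\<bar>) summable_on B"
    using has_sum_imp_summable [OF f] has_sum_imp_summable [OF g]
      summable_on_iff_abs_summable_on_real [of f A] summable_on_iff_abs_summable_on_real [of g B]
    by simp_all
  then obtain a' b' where ab: "((\<lambda>i. \<bar>f i\<bar>) has_sum a') A" "((\<lambda>j. \<bar>g j\<bar>) has_sum b') B"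
    by (auto simp: summable_on_def)
  have "(\<lambda>(i, j). \<bar>f i\<bar> * \<bar>g j\<bar>) summable_on (A \<times> B)"
  proof (rule summable_on_SigmaI [where g = "\<lambda>i. \<bar>f i\<bar> * b'"])
    show "((\<lambda>j. case (i, j) of (i, j) \<Rightarrow> \<bar>f i\<bar> * \<bar>g j\<bar>) has_sum \<bar>f i\<bar> * b') B" for i
      using ab(2) by (simp add: has_sum_cmult_right)
    show "(\<lambda>i. \<bar>f i\<bar> * b') summable_on A"
      using has_sum_cmult_left [OF ab(1)] by (rule has_sum_imp_summable)
  qed auto
  then have "(\<lambda>p. norm (case p of (i, j) \<Rightarrow> f i * g j)) summable_on (A \<times> B)"
    by (simp add: case_prod_unfold abs_mult)
  then show "(\<lambda>(i, j). f i * g j) summable_on (A \<times> B)"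
    by (rule abs_summable_summable)
qed

lemma real_analytic_on_product:
  assumes "\<And>x y z. (x, y, z) \<in> S \<Longrightarrow>
    has_power_series f x \<and> has_power_series g y \<and> has_power_series k z"
  shows "real_analytic_on (\<lambda>(x, y, z). f x * (g y * k z)) S"
proof -
  define F where "F = (\<lambda>(x, y, z). f x * (g y * k z))"
  have "real_analytic_on F S"
    unfolding real_analytic_on_def
  proof clarify
  fix x y z assume "(x, y, z) \<in> S"
  then have ps: "has_power_series f x" "has_power_series g y" "has_power_series k z"
    using assms by blast+
  obtain e1 c1 where 1: "e1 > 0" "\<And>h. \<bar>h\<bar> < e1 \<Longrightarrow> ((\<lambda>n. h ^ n * c1 n) has_sum f (x + h)) UNIV"
    using ps(1) unfolding has_power_series_def by blast
  obtain e2 c2 where 2: "e2 > 0" "\<And>h. \<bar>h\<bar> < e2 \<Longrightarrow> ((\<lambda>n. h ^ n * c2 n) has_sum g (y + h)) UNIV"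
    using ps(2) unfolding has_power_series_def by blast
  obtain e3 c3 where 3: "e3 > 0" "\<And>h. \<bar>h\<bar> < e3 \<Longrightarrow> ((\<lambda>n. h ^ n * c3 n) has_sum k (z + h)) UNIV"
    using ps(3) unfolding has_power_series_def by blast
  have "((\<lambda>(i, j, l). (h1 ^ i * h2 ^ j * h3 ^ l) *\<^sub>R (\<lambda>(i, j, l). c1 i * c2 j * c3 l) (i, j, l))
      has_sum F (x + h1, y + h2, z + h3)) UNIV"
    if "\<bar>h1\<bar> < min e1 (min e2 e3)" "\<bar>h2\<bar> < min e1 (min e2 e3)" "\<bar>h3\<bar> < min e1 (min e2 e3)"
    for h1 h2 h3
  proof -
    have "((\<lambda>(i, j, l). (h1 ^ i * c1 i) * ((h2 ^ j * c2 j) * (h3 ^ l * c3 l))) has_sum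
        f (x + h1) * (g (y + h2) * k (z + h3))) (UNIV \<times> UNIV \<times> UNIV)"
      using has_sum_product_real [OF 1(2) has_sum_product_real [OF 2(2) 3(2)], of h1 h2 h3] that
      by (simp add: case_prod_unfold)
    then show ?thesis by (simp add: F_def case_prod_unfold mult_ac)
  qed
  then show "\<exists>e>0. \<exists>c. \<forall>h1 h2 h3. \<bar>h1\<bar> < e \<longrightarrow> \<bar>h2\<bar> < e \<longrightarrow> \<bar>h3\<bar> < e \<longrightarrow>
      ((\<lambda>(i, j, l). (h1 ^ i * h2 ^ j * h3 ^ l) *\<^sub>R c (i, j, l))
        has_sum F (x + h1, y + h2, z + h3)) UNIV"
    by (intro exI [of _ "min e1 (min e2 e3)"] conjI exI [of _ "\<lambda>(i, j, l). c1 i * c2 j * c3 l"] allI impI)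
       (use 1(1) 2(1) 3(1) in simp)
  qed
  then show ?thesis by (simp add: F_def)
qed

lemma real_analytic_on_add:
  assumes "real_analytic_on f S" "real_analytic_on g S"
  shows "real_analytic_on (\<lambda>p. f p + g p) S"
  unfolding real_analytic_on_def
proof clarify
  fix x y z assume S: "(x, y, z) \<in> S"
  let ?P = "\<lambda>f e c. \<forall>h1 h2 h3. \<bar>h1\<bar> < e \<longrightarrow> \<bar>h2\<bar> < e \<longrightarrow> \<bar>h3\<bar> < e \<longrightarrow>
    ((\<lambda>(i, j, k). (h1 ^ i * h2 ^ j * h3 ^ k) *\<^sub>R c (i, j, k)) has_sum f (x + h1, y + h2, z + h3)) UNIV"
  obtain e c where f: "e > 0" "?P f e c"
    using assms(1) S unfolding real_analytic_on_def by fast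
  obtain e' c' where g: "e' > 0" "?P g e' c'"
    using assms(2) S unfolding real_analytic_on_def by fast
  have "?P (\<lambda>p. f p + g p) (min e e') (\<lambda>q. c q + c' q)"
  proof (intro allI impI)
    fix h1 h2 h3 assume h: "\<bar>h1\<bar> < min e e'" "\<bar>h2\<bar> < min e e'" "\<bar>h3\<bar> < min e e'"
    have "((\<lambda>p. (case p of (i, j, k) \<Rightarrow> (h1 ^ i * h2 ^ j * h3 ^ k) *\<^sub>R c (i, j, k)) +
        (case p of (i, j, k) \<Rightarrow> (h1 ^ i * h2 ^ j * h3 ^ k) *\<^sub>R c' (i, j, k)))
        has_sum (f (x + h1, y + h2, z + h3) + g (x + h1, y + h2, z + h3))) UNIV"
      using f g h by (intro has_sum_add) auto
    then show "((\<lambda>(i, j, k). (h1 ^ i * h2 ^ j * h3 ^ k) *\<^sub>R (c (i, j, k) + c' (i, j, k)))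
        has_sum (f (x + h1, y + h2, z + h3) + g (x + h1, y + h2, z + h3))) UNIV"
      by (simp add: case_prod_unfold scaleR_add_right)
  qed
  then show "\<exists>e>0. \<exists>c. ?P (\<lambda>p. f p + g p) e c"
    by (intro exI [of _ "min e e'"] conjI exI [of _ "\<lambda>q. c q + c' q"]) (use f(1) g(1) in simp)
qed

lemma real_analytic_on_scaleR_const:
  fixes f :: "real \<times> real \<times> real \<Rightarrow> real"
  assumes "real_analytic_on f S"
  shows "real_analytic_on (\<lambda>p. f p *\<^sub>R v) S"
  unfolding real_analytic_on_def
proof clarify
  fix x y z assume S: "(x, y, z) \<in> S"
  obtain e c where f: "e > 0" "\<And>h1 h2 h3. \<bar>h1\<bar> < e \<Longrightarrow> \<bar>h2\<bar> < e \<Longrightarrow> \<bar>h3\<bar> < e \<Longrightarrow>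
    ((\<lambda>(i, j, k). (h1 ^ i * h2 ^ j * h3 ^ k) *\<^sub>R c (i, j, k)) has_sum f (x + h1, y + h2, z + h3)) UNIV"
    using assms(1) S unfolding real_analytic_on_def by fast
  have "((\<lambda>(i, j, k). (h1 ^ i * h2 ^ j * h3 ^ k) *\<^sub>R (c (i, j, k) *\<^sub>R v))
      has_sum f (x + h1, y + h2, z + h3) *\<^sub>R v) UNIV"
    if "\<bar>h1\<bar> < e" "\<bar>h2\<bar> < e" "\<bar>h3\<bar> < e" for h1 h2 h3
    using has_sum_bounded_linear [OF bounded_linear_scaleR_left [of v] f(2) [OF that]]
    by (simp add: case_prod_unfold o_def)
  then show "\<exists>e>0. \<exists>c. \<forall>h1 h2 h3. \<bar>h1\<bar> < e \<longrightarrow> \<bar>h2\<bar> < e \<longrightarrow> \<bar>h3\<bar> < e \<longrightarrow>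
      ((\<lambda>(i, j, k). (h1 ^ i * h2 ^ j * h3 ^ k) *\<^sub>R c (i, j, k)) has_sum f (x + h1, y + h2, z + h3) *\<^sub>R v) UNIV"
    by (intro exI [of _ e] conjI exI [of _ "\<lambda>q. c q *\<^sub>R v"] allI impI) (use f(1) in simp)
qed

lemma real_analytic_on_cong_open:
  assumes "real_analytic_on f S" "open S" "\<And>p. p \<in> S \<Longrightarrow> g p = f p"
  shows "real_analytic_on g S"
  unfolding real_analytic_on_def
proof clarify
  fix x y z assume S: "(x, y, z) \<in> S"
  obtain e c where f: "e > 0" "\<And>h1 h2 h3. \<bar>h1\<bar> < e \<Longrightarrow> \<bar>h2\<bar> < e \<Longrightarrow> \<bar>h3\<bar> < e \<Longrightarrow>
    ((\<lambda>(i, j, k). (h1 ^ i * h2 ^ j * h3 ^ k) *\<^sub>R c (i, j, k)) has_sum f (x + h1, y + h2, z + h3)) UNIV"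
    using assms(1) S unfolding real_analytic_on_def by fast
  obtain d where d: "d > 0" "ball (x, y, z) d \<subseteq> S"
    using assms(2) S by (meson open_contains_ball)
  have "(x + h1, y + h2, z + h3) \<in> S" if "\<bar>h1\<bar> < d / 3" "\<bar>h2\<bar> < d / 3" "\<bar>h3\<bar> < d / 3" for h1 h2 h3
  proof -
    have "norm (h1, h2, h3) \<le> \<bar>h1\<bar> + (\<bar>h2\<bar> + \<bar>h3\<bar>)"
      using norm_Pair_le [of h1 "(h2, h3)"] norm_Pair_le [of h2 h3] by simp
    then have "norm (h1, h2, h3) < d" using that by linarith
    moreover have "dist (x, y, z) (x + h1, y + h2, z + h3) = norm (h1, h2, h3)"
      using norm_minus_cancel [of "(h1, h2, h3)"] by (simp add: dist_norm)
    ultimately show ?thesis using d(2) by auto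
  qed
  then have "((\<lambda>(i, j, k). (h1 ^ i * h2 ^ j * h3 ^ k) *\<^sub>R c (i, j, k)) has_sum g (x + h1, y + h2, z + h3)) UNIV"
    if "\<bar>h1\<bar> < min e (d / 3)" "\<bar>h2\<bar> < min e (d / 3)" "\<bar>h3\<bar> < min e (d / 3)" for h1 h2 h3
    using f(2) [of h1 h2 h3] assms(3) that by simp
  then show "\<exists>e>0. \<exists>c. \<forall>h1 h2 h3. \<bar>h1\<bar> < e \<longrightarrow> \<bar>h2\<bar> < e \<longrightarrow> \<bar>h3\<bar> < e \<longrightarrow>
      ((\<lambda>(i, j, k). (h1 ^ i * h2 ^ j * h3 ^ k) *\<^sub>R c (i, j, k)) has_sum g (x + h1, y + h2, z + h3)) UNIV"
    by (intro exI [of _ "min e (d / 3)"] conjI exI [of _ c] allI impI) (use f(1) d(1) in simp)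
qed

text \<open>Each coordinate is a sum of two products of one-variable analytic functions, and the vector-valued
series is assembled from the three coordinate series along the standard basis.\<close>

lemma real_analytic_param_map: "real_analytic_on param_map param_box"
proof -
  define m where "m f g k = (\<lambda>(x, y, z). f x * (g y * k z) :: real)" for f g k :: "real \<Rightarrow> real"
  have m: "real_analytic_on (m f g k) param_box"
    if "\<And>x. x > 1 \<Longrightarrow> has_power_series f x" "\<And>y. has_power_series g y" "\<And>z. has_power_series k z"
    for f g k
    unfolding m_def using that by (intro real_analytic_on_product) (auto simp: param_box_def)
  note ps = has_power_series_power [of 1, simplified] has_power_series_power [of 2]
    has_power_series_inverse_power [of _ 1, simplified] has_power_series_inverse_power [of _ 2]
    has_power_series_cos has_power_series_const
  let ?one = "\<lambda>_. 1 :: real"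
  have "real_analytic_on (\<lambda>p.
      ((m (\<lambda>r. r) cos ?one p + m inverse ?one cos p) *\<^sub>R (1 :: real, 0 :: real, 0 :: real) +
       (m inverse cos ?one p + m (\<lambda>r. r) ?one cos p) *\<^sub>R (0, 1, 0)) +
       (m (\<lambda>r. r\<^sup>2) ?one ?one p + m (\<lambda>r. inverse (r\<^sup>2)) ?one ?one p) *\<^sub>R (0, 0, 1)) param_box"
    by (intro real_analytic_on_add real_analytic_on_scaleR_const m ps) auto
  then show ?thesis
    by (rule real_analytic_on_cong_open [OF _ open_param_box])
       (auto simp: m_def param_map_def divide_inverse mult.commute)
qed

section \<open>The maps on conjugacy classes\<close>

lemma conj_rel_refl: "A \<in> SL2H \<Longrightarrow> (A, A) \<in> conj_rel"
  using equiv_conj_rel by (auto simp: equiv_def refl_on_def)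

lemma loxodromic_SL2H: "loxodromic A \<Longrightarrow> A \<in> SL2H"
  by (simp add: loxodromic_def)

lemma loxodromic_lox_params:
  assumes "loxodromic A"
  shows "lox_normal_form A (lox_params A)" "\<exists>!p. lox_normal_form A p"
proof -
  obtain p where "lox_normal_form A p" using loxodromic_normal_form [OF assms] .
  then show "lox_normal_form A (lox_params A)" "\<exists>!p. lox_normal_form A p"
    using lox_normal_form_unique by blast+
qed

lemma lox_params_conj:
  assumes "(A, B) \<in> conj_rel"
  shows "lox_params B = lox_params A"
  using lox_normal_form_conj [OF assms] by (simp add: lox_params_def)

lemma on_class_conj_class:
  assumes "A \<in> SL2H" "\<And>B. (A, B) \<in> conj_rel \<Longrightarrow> f B = f A"
  shows "on_class f (conj_class A) = f A"
proof -
  have "f ` conj_class A = {f A}"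
  proof
    have "A \<in> conj_class A" using conj_rel_refl [OF assms(1)] by (simp add: conj_class_def)
    then show "{f A} \<subseteq> f ` conj_class A" by simp
    show "f ` conj_class A \<subseteq> {f A}"
    proof (rule image_subsetI)
      fix B assume "B \<in> conj_class A"
      then show "f B \<in> {f A}" using assms(2) [of B] by (simp add: conj_class_def)
    qed
  qed
  then show ?thesis by (simp add: on_class_def)
qed

lemma class_values:
  assumes "A \<in> SL2H"
  shows "Theta (conj_class A) = (trH A, trH (matrix_inv A), nu A)"
    "Theta_sq (conj_class A) = (trH A, trH (matrix_inv A), trH (A ** A))"
    "class_params (conj_class A) = lox_params A"
  unfolding Theta_def Theta_sq_def class_params_def
  by (rule on_class_conj_class [OF assms], simp add: conj_rel_invariants lox_params_conj nu_def)+

lemma lox_classes_iff: "C \<in> lox_classes \<longleftrightarrow> (\<exists>A. loxodromic A \<and> C = conj_class A)"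
  by (auto simp: lox_classes_def quotient_def conj_class_def)

lemma reg_classes_iff: "C \<in> reg_classes \<longleftrightarrow> (\<exists>A. regular_loxodromic A \<and> C = conj_class A)"
  by (auto simp: reg_classes_def quotient_def conj_class_def)

lemma reg_classes_subset: "reg_classes \<subseteq> lox_classes"
  by (auto simp: reg_classes_iff lox_classes_iff regular_loxodromic_def)

lemma conj_class_eqI: "(A, B) \<in> conj_rel \<Longrightarrow> conj_class A = conj_class B"
  unfolding conj_class_def by (rule equiv_class_eq [OF equiv_conj_rel])

lemma Theta_loxodromic:
  assumes "loxodromic A"
  shows "Theta (conj_class A) = param_map (lox_params A)"
proof -
  obtain r \<theta> \<phi> where p: "lox_params A = (r, \<theta>, \<phi>)" by (cases "lox_params A") auto
  note inv = lox_normal_form_invariants [OF loxodromic_lox_params(1) [OF assms, unfolded p]]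
  show ?thesis
    by (simp add: class_values loxodromic_SL2H assms p param_map_def nu_def inv(4,5))
qed

text \<open>In the coordinates \<open>(r, \<theta>, \<phi>)\<close> the map \<open>\<Theta>\<close> is the explicit map \<open>param_map\<close>. This reduces injectivity,
bijectivity, analyticity and continuity of \<open>\<Theta>\<close> to statements about three real variables.\<close>

lemma Theta_eq_param_map: "C \<in> lox_classes \<Longrightarrow> Theta C = param_map (class_params C)"
  by (auto simp: lox_classes_iff Theta_loxodromic class_values loxodromic_SL2H)

lemma class_params_inj: "inj_on class_params lox_classes"
proof (rule inj_onI)
  fix C C' assume "C \<in> lox_classes" "C' \<in> lox_classes" and eq: "class_params C = class_params C'"
  then obtain A B where AB: "loxodromic A" "C = conj_class A" "loxodromic B" "C' = conj_class B"
    by (auto simp: lox_classes_iff)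
  then have "lox_params A = lox_params B" using eq by (simp add: class_values loxodromic_SL2H)
  then have "(A, B) \<in> conj_rel"
    using loxodromic_lox_params(1) AB lox_normal_form_imp_conj by metis
  then show "C = C'" using AB conj_class_eqI by simp
qed

lemma class_params_range:
  assumes "C \<in> lox_classes"
  shows "class_params C \<in> {1<..} \<times> {0..pi} \<times> {0..pi}"
proof -
  obtain A where A: "loxodromic A" "C = conj_class A" using assms by (auto simp: lox_classes_iff)
  obtain r \<theta> \<phi> where p: "lox_params A = (r, \<theta>, \<phi>)" by (cases "lox_params A") auto
  show ?thesis
    using lox_normal_form_invariants(1-3) [OF loxodromic_lox_params(1) [OF A(1), unfolded p]] A p
    by (simp add: class_values loxodromic_SL2H)
qed

lemma inj_on_param_map: "inj_on param_map ({1<..} \<times> {0..pi} \<times> {0..pi})"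
proof (rule inj_onI)
  fix p p' :: "real \<times> real \<times> real"
  assume "p \<in> {1<..} \<times> {0..pi} \<times> {0..pi}" "p' \<in> {1<..} \<times> {0..pi} \<times> {0..pi}"
    and eq: "param_map p = param_map p'"
  then obtain r \<theta> \<phi> r' \<theta>' \<phi>' where p: "p = (r, \<theta>, \<phi>)" "p' = (r', \<theta>', \<phi>')"
    and r: "r > 1" "r' > 1" and ang: "\<theta> \<in> {0..pi}" "\<phi> \<in> {0..pi}" "\<theta>' \<in> {0..pi}" "\<phi>' \<in> {0..pi}"
    by auto
  have "r = r'" "cos \<theta> = cos \<theta>'" "cos \<phi> = cos \<phi>'"
    using trace_params_unique [of r r' "cos \<theta>" "cos \<phi>" "cos \<theta>'" "cos \<phi>'"] r eq
    by (simp_all add: p param_map_def)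
  then show "p = p'" using ang cos_inj_pi p by simp
qed

lemma inj_on_Theta: "inj_on Theta lox_classes"
proof (rule inj_onI)
  fix C C' assume C: "C \<in> lox_classes" "C' \<in> lox_classes" and "Theta C = Theta C'"
  then have "class_params C = class_params C'"
    using inj_onD [OF inj_on_param_map] class_params_range by (simp add: Theta_eq_param_map)
  then show "C = C'" using inj_onD [OF class_params_inj] C by blast
qed

lemma inj_on_Theta_sq: "inj_on Theta_sq lox_classes"
proof (rule inj_onI)
  fix C C' assume "C \<in> lox_classes" "C' \<in> lox_classes" and eq: "Theta_sq C = Theta_sq C'"
  then obtain A B where AB: "loxodromic A" "C = conj_class A" "loxodromic B" "C' = conj_class B"
    by (auto simp: lox_classes_iff)
  have "lox_params A = lox_params B"
    using lox_normal_forms_eqI [OF loxodromic_lox_params(1) [OF AB(1)] loxodromic_lox_params(1) [OF AB(3)]]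
      eq AB by (simp add: class_values loxodromic_SL2H)
  then have "(A, B) \<in> conj_rel"
    using loxodromic_lox_params(1) AB lox_normal_form_imp_conj by metis
  then show "C = C'" using AB conj_class_eqI by simp
qed

lemma class_params_bij_betw: "bij_betw class_params reg_classes param_box"
  unfolding bij_betw_def
proof
  show "inj_on class_params reg_classes"
    using class_params_inj reg_classes_subset by (rule inj_on_subset)
  show "class_params ` reg_classes = param_box"
  proof (intro equalityI subsetI)
    fix p assume "p \<in> class_params ` reg_classes"
    then obtain A where A: "regular_loxodromic A" "p = class_params (conj_class A)"
      by (auto simp: reg_classes_iff)
    then have p: "p = lox_params A"
      by (simp add: regular_loxodromic_def class_values loxodromic_SL2H)
    from A(1) obtain r \<theta> \<phi> where nf: "\<theta> \<in> {0<..<pi}" "\<phi> \<in> {0<..<pi}" "lox_normal_form A (r, \<theta>, \<phi>)"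
      by (auto simp: regular_loxodromic_def)
    then show "p \<in> param_box"
      using lox_normal_form_unique(2) [OF nf(3)] lox_normal_form_invariants(1) [OF nf(3)] p
      by (simp add: param_box_def)
  next
    fix p assume "p \<in> param_box"
    then obtain r \<theta> \<phi> where p: "p = (r, \<theta>, \<phi>)" "r > 1" "\<theta> \<in> {0<..<pi}" "\<phi> \<in> {0<..<pi}"
      by (auto simp: param_box_def)
    \<comment> \<open>Every class has a representative with complex entries.\<close>
    define I where "I = Quat 0 1 0 0"
    have I: "I \<in> S2" by (simp add: I_def S2_iff)
    define A where "A = lox_diag I I (r, \<theta>, \<phi>)"
    have A: "loxodromic A" unfolding A_def by (rule lox_diag_loxodromic [OF I I p(2)])
    have "(A, A) \<in> conj_rel"
      using loxodromic_SL2H [OF A] by (rule conj_rel_refl)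
    then have nf: "lox_normal_form A (r, \<theta>, \<phi>)"
      using p I unfolding lox_normal_form_iff by (auto simp: A_def)
    then have "regular_loxodromic A" using A p unfolding regular_loxodromic_def by blast
    moreover have "class_params (conj_class A) = p"
      using lox_normal_form_unique(2) [OF nf] A p by (simp add: class_values loxodromic_SL2H)
    ultimately show "p \<in> class_params ` reg_classes"
      by (auto simp: reg_classes_iff intro!: image_eqI)
  qed
qed

lemma class_params_inv:
  "p \<in> param_box \<Longrightarrow> inv_into reg_classes class_params p \<in> reg_classes"
  "p \<in> param_box \<Longrightarrow> class_params (inv_into reg_classes class_params p) = p"
  using class_params_bij_betw by (auto simp: bij_betw_def inv_into_into f_inv_into_f)

lemma Theta_bij_betw: "bij_betw Theta reg_classes D_set"
proof -
  have "bij_betw (param_map \<circ> class_params) reg_classes D_set"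
    using class_params_bij_betw param_map_bij_betw by (rule bij_betw_trans)
  then show ?thesis
    by (rule bij_betw_cong [THEN iffD1, rotated]) (use reg_classes_subset Theta_eq_param_map in auto)
qed

lemma real_analytic_Theta: "real_analytic_on (Theta \<circ> inv_into reg_classes class_params) param_box"
  by (rule real_analytic_on_cong_open [OF real_analytic_param_map open_param_box])
     (use reg_classes_subset in \<open>auto simp: Theta_eq_param_map class_params_inv subsetD\<close>)

lemma topspace_reg_topology: "topspace reg_topology = reg_classes"
  by (simp add: reg_topology_def topspace_pullback_topology)

text \<open>The topology on regular classes is pulled back along the coordinates, so \<open>class_params\<close> is a
homeomorphism onto the parameter box, and the continuous inverse of \<open>param_map\<close> supplies the rest.\<close>

lemma homeomorphic_map_Theta: "homeomorphic_map reg_topology (top_of_set D_set) Theta"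
proof -
  \<comment> \<open>The inverse homeomorphism: explicit coordinates, then the class with these coordinates.\<close>
  let ?g = "inv_into reg_classes class_params \<circ> param_inv"
  have "continuous_map reg_topology euclidean (id \<circ> class_params)"
    unfolding reg_topology_def by (rule continuous_map_pullback) simp
  then have "continuous_map reg_topology (top_of_set param_box) class_params"
    using bij_betwE [OF class_params_bij_betw]
    by (simp add: continuous_map_in_subtopology topspace_reg_topology image_subset_iff)
  moreover have "continuous_map (top_of_set param_box) (top_of_set D_set) param_map"
    using continuous_on_param_map param_map_in_D_set(1)
    by (auto simp: continuous_map_in_subtopology image_subset_iff)
  ultimately have "continuous_map reg_topology (top_of_set D_set) (param_map \<circ> class_params)"
    by (rule continuous_map_compose)
  then have "continuous_map reg_topology (top_of_set D_set) Theta"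
    by (rule continuous_map_eq)
      (use reg_classes_subset in \<open>auto simp: topspace_reg_topology Theta_eq_param_map\<close>)
  moreover have "continuous_map (top_of_set D_set) reg_topology ?g"
    unfolding reg_topology_def
  proof (rule continuous_map_pullback')
    have "continuous_map (top_of_set D_set) euclidean param_inv"
      using continuous_on_param_inv by simp
    then show "continuous_map (top_of_set D_set) euclidean (class_params \<circ> ?g)"
      by (rule continuous_map_eq) (simp add: class_params_inv param_inv_in_param_box)
    show "topspace (top_of_set D_set) \<subseteq> ?g -` reg_classes"
      by (auto simp: class_params_inv param_inv_in_param_box)
  qed
  moreover have "?g (Theta C) = C" if "C \<in> reg_classes" for C
  proof -
    have "param_inv (Theta C) = class_params C"
      using that reg_classes_subset bij_betwE [OF class_params_bij_betw]
      by (auto simp: Theta_eq_param_map param_map_in_D_set)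
    then show ?thesis
      using that class_params_bij_betw by (simp add: bij_betw_def)
  qed
  moreover have "Theta (?g q) = q" if "q \<in> D_set" for q
    using that reg_classes_subset
    by (auto simp: Theta_eq_param_map class_params_inv param_inv_in_param_box subsetD)
  ultimately have "homeomorphic_maps reg_topology (top_of_set D_set) Theta ?g"
    by (simp add: homeomorphic_maps_def topspace_reg_topology)
  then show ?thesis by (rule homeomorphic_maps_imp_map)
qed

lemma Theta_inverse_formulas:
  assumes "C \<in> reg_classes" "Theta C = (x, y, z)" "class_params C = (r, \<theta>, \<phi>)"
  shows "r = 1/2 * (sqrt (z + 2) + sqrt (z - 2))" "cos \<theta> = u_fun x y z" "cos \<phi> = v_fun x y z"
proof -
  have "r > 1"
    using assms class_params_bij_betw by (force simp: param_box_def dest: bij_betwE)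
  moreover have "(x, y, z) = param_map (r, \<theta>, \<phi>)"
    using assms reg_classes_subset Theta_eq_param_map by (metis subsetD)
  ultimately show "r = 1/2 * (sqrt (z + 2) + sqrt (z - 2))" "cos \<theta> = u_fun x y z" "cos \<phi> = v_fun x y z"
    using param_map_inverts [of r x y z "cos \<theta>" "cos \<phi>"] by (simp_all add: param_map_def)
qed

text \<open>With \<open>c = cos \<theta>\<close> and \<open>d = cos \<phi>\<close>, the identity \<open>x y z - x\<^sup>2 - y\<^sup>2 = c d (z\<^sup>2 - 4)\<close> turns the given
expression for \<open>c2\<close> into \<open>z + 4 c d\<close>, the middle coefficient of the product of the two quadratic
factors of the normal form.\<close>

lemma charpoly_coefficients:
  assumes A: "loxodromic A" and xyz: "x = trH A" "y = trH (matrix_inv A)" "z = nu A"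
    and c2: "c2 = z + 4 * (x * y * z - x\<^sup>2 - y\<^sup>2) / (z\<^sup>2 - 4)"
  shows "charpolyH A = map_poly of_real [:1, - (2 * y), c2, - (2 * x), 1:]"
    "c2 = z + 4 / (z - 2) * (x * y - (x + y)\<^sup>2 / (z + 2))"
    "trH (A ** A) = 2 * x\<^sup>2 - c2"
proof -
  obtain r \<theta> \<phi> where p: "lox_params A = (r, \<theta>, \<phi>)" by (cases "lox_params A") auto
  note inv = lox_normal_form_invariants [OF loxodromic_lox_params(1) [OF A, unfolded p]]
  define c d where "c = cos \<theta>" and "d = cos \<phi>"
  have r: "r > 1" by (fact inv(1))
  have x: "x = r * c + d / r" and y: "y = c / r + r * d" and z: "z = r\<^sup>2 + inverse (r\<^sup>2)"
    by (simp_all add: xyz inv(4,5) nu_def p c_def d_def)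
  have z2: "z > 2" using param_map_inverts(1) [OF r, of x y z c d] x y z by simp
  have xy: "x * y = c\<^sup>2 + d\<^sup>2 + c * d * z" "x\<^sup>2 + y\<^sup>2 = (c\<^sup>2 + d\<^sup>2) * z + 4 * c * d"
    using r unfolding x y z by (simp_all add: field_simps power2_eq_square)
  have "x * y * z - x\<^sup>2 - y\<^sup>2 = c * d * (z\<^sup>2 - 4)"
  proof -
    have "x * y * z - x\<^sup>2 - y\<^sup>2 = x * y * z - (x\<^sup>2 + y\<^sup>2)" by simp
    also have "\<dots> = c * d * (z\<^sup>2 - 4)" unfolding xy by (simp add: power2_eq_square algebra_simps)
    finally show ?thesis .
  qed
  moreover have z4: "z\<^sup>2 - 4 = (z - 2) * (z + 2)" by (simp add: power2_eq_square algebra_simps)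
  moreover have "(z - 2) * (z + 2) > 0" using z2 by (intro mult_pos_pos) simp_all
  ultimately have c2': "c2 = z + 4 * c * d" using c2 z2 by simp
  have "4 / (z - 2) * (x * y - (x + y)\<^sup>2 / (z + 2)) = 4 * (x * y * z - x\<^sup>2 - y\<^sup>2) / ((z - 2) * (z + 2))"
    using z2 by (simp add: field_simps power2_eq_square)
  then show "c2 = z + 4 / (z - 2) * (x * y - (x + y)\<^sup>2 / (z + 2))" using c2 z4 by simp
  show "trH (A ** A) = 2 * x\<^sup>2 - c2"
    using second_coefficient_of_trace [OF r, of c d] unfolding inv(6) c2' z x
    by (simp add: c_def d_def)
  have "[:r\<^sup>2, - 2 * (r * c), 1:] * [:inverse (r\<^sup>2), - 2 * (d / r), 1:] = [:1, - (2 * y), c2, - (2 * x), 1:]"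
    using r unfolding c2' x y z by (simp add: field_simps power2_eq_square)
  then show "charpolyH A = map_poly of_real [:1, - (2 * y), c2, - (2 * x), 1:]"
    using inv(7) by (simp add: c_def d_def)
qed

theorem theorem3p4:
  shows
    "\<comment> \<open>the maps on classes are well defined\<close>
     (\<forall>A. loxodromic A \<longrightarrow>
        conj_class A \<in> lox_classes \<and>
        Theta (conj_class A) = (trH A, trH (matrix_inv A), nu A) \<and>
        Theta_sq (conj_class A) = (trH A, trH (matrix_inv A), trH (A ** A)) \<and>
        (\<exists>!p. lox_normal_form A p) \<and>
        class_params (conj_class A) = lox_params A) \<and>
     bij_betw class_params reg_classes param_box \<and>
     \<comment> \<open>(1)\<close>
     inj_on Theta lox_classes \<and>
     \<comment> \<open>(2)\<close>
     (\<forall>A x y z c2. loxodromic A \<longrightarrow> x = trH A \<longrightarrow> y = trH (matrix_inv A) \<longrightarrow> z = nu A \<longrightarrow>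
        c2 = z + 4 * (x * y * z - x\<^sup>2 - y\<^sup>2) / (z\<^sup>2 - 4) \<longrightarrow>
        charpolyH A = map_poly of_real [:1, - (2 * y), c2, - (2 * x), 1:] \<and>
        c2 = z + 4 / (z - 2) * (x * y - (x + y)\<^sup>2 / (z + 2)) \<and>
        trH (A ** A) = 2 * x\<^sup>2 - c2) \<and>
     inj_on Theta_sq lox_classes \<and>
     (\<forall>C\<in>lox_classes. \<forall>C'\<in>lox_classes. Theta C = Theta C' \<longleftrightarrow> Theta_sq C = Theta_sq C') \<and>
     \<comment> \<open>(3)\<close>
     open D_set \<and>
     real_analytic_on (Theta \<circ> inv_into reg_classes class_params) param_box \<and>
     bij_betw Theta reg_classes D_set \<and>
     (\<forall>C\<in>reg_classes. \<forall>x y z r \<theta> \<phi>.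
        Theta C = (x, y, z) \<longrightarrow> class_params C = (r, \<theta>, \<phi>) \<longrightarrow>
        r = 1/2 * (sqrt (z + 2) + sqrt (z - 2)) \<and>
        cos \<theta> = u_fun x y z \<and> cos \<phi> = v_fun x y z) \<and>
     homeomorphic_map reg_topology (top_of_set D_set) Theta"
proof (intro conjI allI impI ballI)
  fix A assume A: "loxodromic A"
  show "conj_class A \<in> lox_classes" using A by (auto simp: lox_classes_iff)
  show "Theta (conj_class A) = (trH A, trH (matrix_inv A), nu A)"
    "Theta_sq (conj_class A) = (trH A, trH (matrix_inv A), trH (A ** A))"
    "class_params (conj_class A) = lox_params A"
    using loxodromic_SL2H [OF A] by (rule class_values)+
  show "\<exists>!p. lox_normal_form A p" using A by (rule loxodromic_lox_params)
next
  fix C C' assume C: "C \<in> lox_classes" "C' \<in> lox_classes"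
  show "Theta C = Theta C' \<longleftrightarrow> Theta_sq C = Theta_sq C'"
    using inj_on_eq_iff [OF inj_on_Theta C] inj_on_eq_iff [OF inj_on_Theta_sq C] by simp
qed (fact class_params_bij_betw inj_on_Theta inj_on_Theta_sq open_D_set real_analytic_Theta
      Theta_bij_betw homeomorphic_map_Theta
    | (rule charpoly_coefficients Theta_inverse_formulas; assumption))+

end
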